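(* Let $A$, $A_1$, $B$, $B_1$, $B_2$, $B_3$, $C_1$, $C_1-A_1$ and $\mathbb{Y}$ be positive stable matrices in $\mathbb{C}^{r\times r}$ such that $A$, $A_1$, $B$, $C_1$, $\mathbb{Y}$ commute with each other and $B_iB_j=B_jB_i$ for $1\le i,j\le3$. Then for all integers $m,n,p\ge0$ and all $z,w,v\in\mathbb{C}$ with $|z|<1$, $|w|<1$, $|v|<1$, $$\begin{aligned}\frac{\partial^{m+n+p}}{\partial z^m\,\partial w^n\,\partial v^p}&F^{(3;A,B)}_{D,\mathbb{Y}}(A_1,B_1,B_2,B_3;C_1;z,w,v)\\&=(A_1)_{m+n+p}(C_1)_{m+n+p}^{-1}\\&\quad\times F^{(3;A,B)}_{D,\mathbb{Y}}(A_1+(m+n+p)I,B_1+mI,B_2+nI,B_3+pI;C_1+(m+n+p)I;z,w,v)\\&\quad\times(B_1)_m(B_2)_n(B_3)_p.\end{aligned}$$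
   Context: A matrix in $\mathbb{C}^{r\times r}$ is positive stable if all its eigenvalues have positive real part; $I$ is the identity matrix. For $t>0$ and a square matrix $M$, $t^M=\exp(M\ln t)$. The Pochhammer symbol is $(M)_0=I$, $(M)_n=M(M+I)\cdots(M+(n-1)I)$ for $n\ge1$, and $(M)_n^{-1}$ is the inverse of $(M)_n$. For positive stable $B$ and a square matrix $W$, ${}_1F_1(A;B;W)=\sum_{n\ge0}(A)_n\,(B)_n^{-1}\,\frac{W^n}{n!}$. For commuting positive stable $P,Q$, the beta matrix function is $\mathfrak{B}(P,Q)=\Gamma(P)\Gamma(Q)\Gamma^{-1}(P+Q)=\int_0^1t^{P-I}(1-t)^{Q-I}dt$, where $\Gamma(P)=\int_0^\infty e^{-t}t^{P-I}dt$. For positive stable $A,B,P,Q,\mathbb{Y}$, $$\mathfrak{B}_{\mathbb{Y}}^{(A,B)}(P,Q)=\int_0^1 {}_1F_1\!\left(A;B;-\frac{\mathbb{Y}}{t(1-t)}\right)t^{P-I}(1-t)^{Q-I}\,dt .$$ The new extended Lauricella matrix function of three variables is $$\begin{aligned}F^{(3;A,B)}_{D,\mathbb{Y}}(A_1,B_1,B_2,B_3;C_1;z,w,v)=\sum_{m,n,p\ge0}&\mathfrak{B}_{\mathbb{Y}}^{(A,B)}(A_1+(m+n+p)I,C_1-A_1)[\mathfrak{B}(A_1,C_1-A_1)]^{-1}\\&\times(B_1)_m(B_2)_n(B_3)_p\frac{z^mw^nv^p}{m!\,n!\,p!}.\end{aligned}$$ *)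

theory Defs
  imports "HOL-Analysis.Analysis"
begin

text \<open>
  Square complex matrices have type \<open>complex^'r^'r\<close>. On this type \<open>*\<close>, \<open>1\<close> and \<open>^\<close> are the
  componentwise operations, so only \<open>**\<close>, \<open>mat 1\<close> and \<open>mpower\<close> are used below; \<open>mat c\<close> is
  the scalar matrix \<open>c I\<close>, and multiplication by it stands for scaling by \<open>c\<close>.
\<close>

definition positive_stable :: "complex^'r^'r \<Rightarrow> bool" where
  "positive_stable M \<longleftrightarrow> (\<forall>\<mu> x. x \<noteq> 0 \<and> M *v x = \<mu> *s x \<longrightarrow> Re \<mu> > 0)"

primrec mpower :: "complex^'r^'r \<Rightarrow> nat \<Rightarrow> complex^'r^'r" where
  "mpower M 0 = mat 1"
| "mpower M (Suc n) = mpower M n ** M"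

definition mexp :: "complex^'r^'r \<Rightarrow> complex^'r^'r" where
  "mexp M = (\<Sum>n. (1 / fact n) *\<^sub>R mpower M n)"

definition mpowr :: "real \<Rightarrow> complex^'r^'r \<Rightarrow> complex^'r^'r" where
  "mpowr t M = mexp (ln t *\<^sub>R M)"

primrec mpochhammer :: "complex^'r^'r \<Rightarrow> nat \<Rightarrow> complex^'r^'r" where
  "mpochhammer M 0 = mat 1"
| "mpochhammer M (Suc n) = mpochhammer M n ** (M + mat (of_nat n))"

definition mhyp_1F1 :: "complex^'r^'r \<Rightarrow> complex^'r^'r \<Rightarrow> complex^'r^'r \<Rightarrow> complex^'r^'r" where
  "mhyp_1F1 A B W =
     (\<Sum>n. mpochhammer A n ** matrix_inv (mpochhammer B n) ** ((1 / fact n) *\<^sub>R mpower W n))"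

definition mGamma :: "complex^'r^'r \<Rightarrow> complex^'r^'r" where
  "mGamma P = (LINT t:{0<..}|lborel. exp (- t) *\<^sub>R mpowr t (P - mat 1))"

definition mBeta :: "complex^'r^'r \<Rightarrow> complex^'r^'r \<Rightarrow> complex^'r^'r" where
  "mBeta P Q = mGamma P ** mGamma Q ** matrix_inv (mGamma (P + Q))"

definition ext_mBeta :: "complex^'r^'r \<Rightarrow> complex^'r^'r \<Rightarrow> complex^'r^'r \<Rightarrow>
    complex^'r^'r \<Rightarrow> complex^'r^'r \<Rightarrow> complex^'r^'r" where
  "ext_mBeta A B Y P Q =
     (LINT t:{0<..<1}|lborel. mhyp_1F1 A B (- ((1 / (t * (1 - t))) *\<^sub>R Y))
        ** mpowr t (P - mat 1) ** mpowr (1 - t) (Q - mat 1))"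

definition ext_Lauricella_FD3 :: "complex^'r^'r \<Rightarrow> complex^'r^'r \<Rightarrow> complex^'r^'r \<Rightarrow>
    complex^'r^'r \<Rightarrow> complex^'r^'r \<Rightarrow> complex^'r^'r \<Rightarrow> complex^'r^'r \<Rightarrow> complex^'r^'r \<Rightarrow>
    complex \<Rightarrow> complex \<Rightarrow> complex \<Rightarrow> complex^'r^'r" where
  "ext_Lauricella_FD3 A B Y A1 B1 B2 B3 C1 z w v =
     (\<Sum>\<^sub>\<infinity>(m, n, p)\<in>UNIV.
        ext_mBeta A B Y (A1 + mat (of_nat (m + n + p))) (C1 - A1)
        ** matrix_inv (mBeta A1 (C1 - A1))
        ** mpochhammer B1 m ** mpochhammer B2 n ** mpochhammer B3 p
        ** mat (z ^ m * w ^ n * v ^ p / (fact m * fact n * fact p)))"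

text \<open>
  Partial complex derivatives of matrix-valued functions of three complex variables, taken
  entrywise. Since \<open>deriv\<close> is total, existence is expressed separately:
  \<open>mixed_partial_exists S m n p f\<close> says that on \<open>S\<close> (meant to be open) every single
  differentiation step leading to \<open>mixed_partial m n p f\<close> is one of a differentiable function.
\<close>

definition partial1 :: "(complex \<Rightarrow> complex \<Rightarrow> complex \<Rightarrow> complex^'r^'r) \<Rightarrow>
    complex \<Rightarrow> complex \<Rightarrow> complex \<Rightarrow> complex^'r^'r" where
  "partial1 f = (\<lambda>z w v. \<chi> i j. deriv (\<lambda>x. f x w v $ i $ j) z)"

definition partial2 :: "(complex \<Rightarrow> complex \<Rightarrow> complex \<Rightarrow> complex^'r^'r) \<Rightarrow>
    complex \<Rightarrow> complex \<Rightarrow> complex \<Rightarrow> complex^'r^'r" where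
  "partial2 f = (\<lambda>z w v. \<chi> i j. deriv (\<lambda>x. f z x v $ i $ j) w)"

definition partial3 :: "(complex \<Rightarrow> complex \<Rightarrow> complex \<Rightarrow> complex^'r^'r) \<Rightarrow>
    complex \<Rightarrow> complex \<Rightarrow> complex \<Rightarrow> complex^'r^'r" where
  "partial3 f = (\<lambda>z w v. \<chi> i j. deriv (\<lambda>x. f z w x $ i $ j) v)"

definition mixed_partial :: "nat \<Rightarrow> nat \<Rightarrow> nat \<Rightarrow>
    (complex \<Rightarrow> complex \<Rightarrow> complex \<Rightarrow> complex^'r^'r) \<Rightarrow>
    complex \<Rightarrow> complex \<Rightarrow> complex \<Rightarrow> complex^'r^'r" where
  "mixed_partial m n p f = (partial1 ^^ m) ((partial2 ^^ n) ((partial3 ^^ p) f))"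

definition mixed_partial_exists :: "(complex \<times> complex \<times> complex) set \<Rightarrow> nat \<Rightarrow> nat \<Rightarrow> nat \<Rightarrow>
    (complex \<Rightarrow> complex \<Rightarrow> complex \<Rightarrow> complex^'r^'r) \<Rightarrow> bool" where
  "mixed_partial_exists S m n p f \<longleftrightarrow>
     (\<forall>(z, w, v)\<in>S. \<forall>i j.
        (\<forall>k<p. (\<lambda>x. mixed_partial 0 0 k f z w x $ i $ j) field_differentiable (at v)) \<and>
        (\<forall>k<n. (\<lambda>x. mixed_partial 0 k p f z x v $ i $ j) field_differentiable (at w)) \<and>
        (\<forall>k<m. (\<lambda>x. mixed_partial k n p f x w v $ i $ j) field_differentiable (at z)))"

end

(*
  On the open polydisc the function is a power series whose coefficients are, up to a constant
  factor, bounded by products of Pochhammer symbols over factorials, so it may be differentiated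
  termwise; differentiation shifts the coefficients. The shifted coefficients are those of the
  function with raised parameters because (B)_(m+m') = (B)_m (B + m I)_m' and because the Gamma
  matrix function satisfies Gamma(P + k I) = (P)_k Gamma(P). The latter is integration by parts; it
  needs exponential decay of exp(-s P), which, like the invertibility of Gamma(P), is proved by
  induction along the linear factors of a polynomial annihilating a given vector.
*)

theory Submission
  imports Defs "HOL-Computational_Algebra.Fundamental_Theorem_Algebra" "HOL-Real_Asymp.Real_Asymp"
begin

section \<open>Matrix algebra and norms\<close>

text \<open>The obstacle is that two families of matrices meet which are not assumed to commute with
  each other: \<open>A\<close>, \<open>A1\<close>, \<open>B\<close>, \<open>C1\<close>,
  \<open>Y\<close> and \<open>B1\<close>, \<open>B2\<close>, \<open>B3\<close>. The formula respects
  this because the index shift leaves the extended beta value unchanged: raising \<open>A1\<close>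
  and \<open>C1\<close> by the same multiple of the identity preserves \<open>C1 - A1\<close>, and
  the first argument only records the total index. On the left only the normalising beta matrix
  changes, and its change is exactly (A1)_k (C1)_k^(-1) with k = m + n + p. On the right the
  split-off Pochhammer factors move only past factors of their own family. The norm of a matrix is
  the Frobenius norm, so the identity has norm sqrt r. Scalar summands are therefore separated
  before estimating; otherwise the bound for (B)_k would pick up a factor sqrt(r)^k and the unit
  polydisc would be lost. The extended beta integrals are handled through the totality of the
  Bochner integral: both the coefficient bound and the commutation argument also cover the value 0
  of a non-integrable integrand.\<close>

lemma norm_smult_vec: "norm (c *s x) = norm c * norm x" for x :: "complex^'n"
  by (simp add: norm_vec_def norm_mult L2_set_right_distrib)

lemma norm_vector_matrix_sum_le:
  fixes a :: "'n::finite \<Rightarrow> complex" and x :: "'n \<Rightarrow> complex^'m"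
  shows "norm (\<Sum>k\<in>UNIV. a k *s x k) \<le> L2_set (\<lambda>k. norm (a k)) UNIV * L2_set (\<lambda>k. norm (x k)) UNIV"
proof -
  have "norm (\<Sum>k\<in>UNIV. a k *s x k) \<le> (\<Sum>k\<in>UNIV. norm (a k *s x k))"
    by (rule norm_sum)
  also have "\<dots> = (\<Sum>k\<in>UNIV. \<bar>norm (a k)\<bar> * \<bar>norm (x k)\<bar>)"
    by (simp add: norm_smult_vec)
  also have "\<dots> \<le> L2_set (\<lambda>k. norm (a k)) UNIV * L2_set (\<lambda>k. norm (x k)) UNIV"
    by (rule L2_set_mult_ineq)
  finally show ?thesis .
qed

text \<open>Row \<open>i\<close> of the product is the combination of the rows of \<open>B\<close>
  with coefficients \<open>A $ i\<close>, so Cauchy-Schwarz bounds it by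
  \<open>norm (A $ i) * norm B\<close>; the rows are then collected in the L2 norm.\<close>

lemma norm_matrix_mult_le: "norm (A ** B) \<le> norm A * norm B"
  for A :: "complex^'n^'k" and B :: "complex^'m^'n"
proof -
  have "norm ((A ** B) $ i) \<le> norm (A $ i) * norm B" for i
  proof -
    have "(A ** B) $ i = (\<Sum>k\<in>UNIV. A $ i $ k *s B $ k)"
      by (simp add: vec_eq_iff matrix_matrix_mult_def)
    then show ?thesis
      using norm_vector_matrix_sum_le[of "\<lambda>k. A $ i $ k" "\<lambda>k. B $ k"] by (simp add: norm_vec_def)
  qed
  then have "L2_set (\<lambda>i. norm ((A ** B) $ i)) UNIV \<le> L2_set (\<lambda>i. norm (A $ i) * norm B) UNIV"
    by (intro L2_set_mono) auto
  also have "\<dots> = norm A * norm B"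
    by (simp add: L2_set_left_distrib norm_vec_def[of A])
  finally show ?thesis by (simp add: norm_vec_def[of "A ** B"])
qed

lemma norm_matrix_vector_mult_le: "norm (A *v x) \<le> norm A * norm x"
  for A :: "complex^'n^'k"
proof -
  have "norm ((A *v x) $ i) \<le> norm (A $ i) * norm x" for i
  proof -
    have "norm ((A *v x) $ i) \<le> (\<Sum>k\<in>UNIV. \<bar>norm (A $ i $ k)\<bar> * \<bar>norm (x $ k)\<bar>)"
      unfolding matrix_vector_mult_def by (auto intro!: sum_norm_le simp: norm_mult)
    also have "\<dots> \<le> norm (A $ i) * norm x"
      unfolding norm_vec_def by (rule L2_set_mult_ineq)
    finally show ?thesis .
  qed
  then have "L2_set (\<lambda>i. norm ((A *v x) $ i)) UNIV \<le> L2_set (\<lambda>i. norm (A $ i) * norm x) UNIV"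
    by (intro L2_set_mono) auto
  also have "\<dots> = norm A * norm x"
    by (simp add: L2_set_left_distrib norm_vec_def[of A])
  finally show ?thesis by (simp add: norm_vec_def[of "A *v x"])
qed

lemma scaleR_matrix_mult_left: "(c *\<^sub>R A) ** B = c *\<^sub>R (A ** B)"
  for A :: "complex^'n^'k" and B :: "complex^'m^'n"
  by (simp add: vec_eq_iff matrix_matrix_mult_def scaleR_sum_right)

lemma scaleR_matrix_mult_right: "A ** (c *\<^sub>R B) = c *\<^sub>R (A ** B)"
  for A :: "complex^'n^'k" and B :: "complex^'m^'n"
  by (simp add: vec_eq_iff matrix_matrix_mult_def scaleR_sum_right)

lemma matrix_diff_ldistrib: "A ** (B - C) = A ** B - A ** C"
  for A :: "complex^'n^'k" and B :: "complex^'m^'n"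
  by (simp add: vec_eq_iff matrix_matrix_mult_def algebra_simps sum_subtractf)

lemma matrix_diff_rdistrib: "(A - B) ** C = A ** C - B ** C"
  for A :: "complex^'n^'k" and C :: "complex^'m^'n"
  by (simp add: vec_eq_iff matrix_matrix_mult_def algebra_simps sum_subtractf)

lemma matrix_add_rdistrib': "(A + B) ** C = A ** C + B ** C"
  for A :: "complex^'n^'k" and C :: "complex^'m^'n"
  by (simp add: vec_eq_iff matrix_matrix_mult_def algebra_simps sum.distrib)

lemma mat_mult_left: "mat c ** A = (\<chi> i j. c * A $ i $ j)" for A :: "complex^'m^'n"
  by (simp add: vec_eq_iff matrix_matrix_mult_def mat_def if_distrib if_distribR cong: if_cong)

lemma mat_mult_right: "A ** mat c = (\<chi> i j. A $ i $ j * c)" for A :: "complex^'m^'n"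
  by (simp add: vec_eq_iff matrix_matrix_mult_def mat_def if_distrib if_distribR cong: if_cong)

lemma mat_of_real_mult: "mat (of_real c) ** A = c *\<^sub>R A" for A :: "complex^'m^'n"
  unfolding mat_mult_left vec_eq_iff by (simp add: scaleR_conv_of_real[symmetric])

lemma mat_vector_mult: "mat c *v x = c *s x" for x :: "complex^'n"
  by (simp add: vec_eq_iff matrix_vector_mult_def mat_def if_distrib if_distribR cong: if_cong)

lemma mat_add: "mat (a + b) = mat a + mat b" for a :: complex
  by (simp add: vec_eq_iff mat_def)

lemma bounded_bilinear_matrix_mult:
  "bounded_bilinear ((**) :: complex^'n^'k \<Rightarrow> complex^'m^'n \<Rightarrow> complex^'m^'k)"
  by standard
    (auto simp: matrix_add_ldistrib matrix_add_rdistrib' scaleR_matrix_mult_left scaleR_matrix_mult_right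
       intro!: exI[of _ 1] norm_matrix_mult_le)

lemmas bounded_linear_matrix_mult_left =
    bounded_bilinear.bounded_linear_left[OF bounded_bilinear_matrix_mult]
  and bounded_linear_matrix_mult_right =
    bounded_bilinear.bounded_linear_right[OF bounded_bilinear_matrix_mult]

lemma bounded_bilinear_matrix_vector_mult:
  "bounded_bilinear ((*v) :: complex^'n^'k \<Rightarrow> complex^'n \<Rightarrow> complex^'k)"
proof
  show "(c *\<^sub>R A) *v x = c *\<^sub>R (A *v x)" for c and A :: "complex^'n^'k" and x
    by (simp add: vec_eq_iff matrix_vector_mult_def scaleR_sum_right)
  show "A *v (c *\<^sub>R x) = c *\<^sub>R (A *v x)" for c and A :: "complex^'n^'k" and x
    by (simp add: vec_eq_iff matrix_vector_mult_def scaleR_sum_right)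
qed (auto simp: matrix_vector_mult_add_rdistrib matrix_vector_right_distrib
    intro!: exI[of _ 1] norm_matrix_vector_mult_le)

lemmas bounded_linear_matrix_vector_mult_left =
    bounded_bilinear.bounded_linear_left[OF bounded_bilinear_matrix_vector_mult]

section \<open>Inverses of square matrices\<close>

lemma matrix_inv_invertible:
  assumes "invertible (M :: complex^'n^'n)"
  shows "M ** matrix_inv M = mat 1" "matrix_inv M ** M = mat 1"
proof -
  have "\<exists>X. M ** X = mat 1 \<and> X ** M = mat 1"
    using assms by (auto simp: invertible_def)
  from someI_ex[OF this] show "M ** matrix_inv M = mat 1" "matrix_inv M ** M = mat 1"
    by (auto simp: matrix_inv_def)
qed

lemma matrix_inv_eqI:
  fixes M X :: "complex^'n^'n"
  assumes "M ** X = mat 1" "X ** M = mat 1"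
  shows "matrix_inv M = X"
proof -
  have "invertible M"
    using assms by (auto simp: invertible_def)
  note inv = matrix_inv_invertible[OF this]
  have "matrix_inv M = matrix_inv M ** (M ** X)"
    using assms by simp
  also have "\<dots> = X"
    using inv by (simp add: matrix_mul_assoc)
  finally show ?thesis .
qed

lemma invertible_matrix_inv: "invertible M \<Longrightarrow> invertible (matrix_inv M)" for M :: "complex^'n^'n"
  using matrix_inv_invertible[of M] by (auto simp: invertible_def)

lemma matrix_inv_mult:
  fixes M N :: "complex^'n^'n"
  assumes "invertible M" "invertible N"
  shows "matrix_inv (M ** N) = matrix_inv N ** matrix_inv M"
proof (rule matrix_inv_eqI)
  have "M ** N ** (matrix_inv N ** matrix_inv M) = M ** (N ** matrix_inv N) ** matrix_inv M"
    by (simp only: matrix_mul_assoc)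
  then show "M ** N ** (matrix_inv N ** matrix_inv M) = mat 1"
    by (simp only: matrix_inv_invertible[OF assms(1)] matrix_inv_invertible[OF assms(2)] matrix_mul_rid)
  have "matrix_inv N ** matrix_inv M ** (M ** N) = matrix_inv N ** (matrix_inv M ** M) ** N"
    by (simp only: matrix_mul_assoc)
  then show "matrix_inv N ** matrix_inv M ** (M ** N) = mat 1"
    by (simp only: matrix_inv_invertible[OF assms(1)] matrix_inv_invertible[OF assms(2)] matrix_mul_rid)
qed

lemma invertible_if_kernel_trivial:
  fixes M :: "complex^'n^'n"
  assumes "\<And>x. M *v x = 0 \<Longrightarrow> x = 0"
  shows "invertible M"
  using assms by (simp add: invertible_left_inverse matrix_left_invertible_ker)

section \<open>The commutant of a matrix and its closure properties\<close>

definition mcomm :: "complex^'n^'n \<Rightarrow> complex^'n^'n \<Rightarrow> bool" where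
  "mcomm M N \<longleftrightarrow> M ** N = N ** M"

lemma mcomm_sym: "mcomm M N \<Longrightarrow> mcomm N M"
  by (simp add: mcomm_def)

lemma mcomm_refl [simp]: "mcomm M M"
  by (simp add: mcomm_def)

lemma mcomm_mat [simp]: "mcomm M (mat c)" "mcomm (mat c) M"
  by (simp_all add: mcomm_def mat_mult_left mat_mult_right mult.commute)

lemma mcomm_add: "mcomm M N \<Longrightarrow> mcomm M N' \<Longrightarrow> mcomm M (N + N')"
  by (simp add: mcomm_def matrix_add_ldistrib matrix_add_rdistrib')

lemma mcomm_diff: "mcomm M N \<Longrightarrow> mcomm M N' \<Longrightarrow> mcomm M (N - N')"
  by (simp add: mcomm_def matrix_diff_ldistrib matrix_diff_rdistrib)

lemma mcomm_mult: "mcomm M N \<Longrightarrow> mcomm M N' \<Longrightarrow> mcomm M (N ** N')"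
  unfolding mcomm_def by (metis matrix_mul_assoc)

lemma mcomm_scaleR: "mcomm M N \<Longrightarrow> mcomm M (c *\<^sub>R N)"
  by (simp add: mcomm_def scaleR_matrix_mult_left scaleR_matrix_mult_right)

lemma mcomm_uminus: "mcomm M N \<Longrightarrow> mcomm M (- N)"
  using mcomm_scaleR[of M N "-1"] by simp

lemma mcomm_mpower: "mcomm M N \<Longrightarrow> mcomm M (mpower N k)"
  by (induction k) (auto intro: mcomm_mult)

lemma mcomm_mpochhammer: "mcomm M N \<Longrightarrow> mcomm M (mpochhammer N k)"
  by (induction k) (auto intro!: mcomm_mult mcomm_add)

lemma mcomm_matrix_inv:
  assumes "mcomm M N" "invertible N"
  shows "mcomm M (matrix_inv N)"
proof -
  have "matrix_inv N ** (N ** M) ** matrix_inv N = matrix_inv N ** (M ** N) ** matrix_inv N"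
    using assms by (simp add: mcomm_def)
  then have "M ** matrix_inv N = matrix_inv N ** M"
    using matrix_inv_invertible[OF assms(2)]
    by (metis matrix_mul_assoc matrix_mul_lid matrix_mul_rid)
  then show ?thesis by (simp add: mcomm_def)
qed

lemma mcomm_suminf:
  assumes "summable f" "\<And>k. mcomm M (f k)"
  shows "mcomm M (suminf f)"
proof -
  have "M ** suminf f = (\<Sum>k. M ** f k)"
    using bounded_linear.suminf[OF bounded_linear_matrix_mult_right assms(1)] .
  also have "\<dots> = (\<Sum>k. f k ** M)"
    using assms(2) by (simp add: mcomm_def)
  also have "\<dots> = suminf f ** M"
    using bounded_linear.suminf[OF bounded_linear_matrix_mult_left assms(1), of M] by simp
  finally show ?thesis by (simp add: mcomm_def)
qed

text \<open>For integrable \<open>f\<close>, multiplication by \<open>M\<close> from either side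
  passes under the integral; otherwise the integral is 0 by convention, which commutes with
  everything. The lemma thus applies to extended beta integrals without a convergence proof.\<close>

lemma mcomm_set_integral:
  assumes "\<And>t. t \<in> S \<Longrightarrow> mcomm M (f t)"
  shows "mcomm M (LINT t:S|lborel. f t)"
proof (cases "set_integrable lborel S f")
  case True
  then have "integrable lborel (\<lambda>t. indicator S t *\<^sub>R f t)"
    by (simp add: set_integrable_def)
  note int = integral_bounded_linear[OF bounded_linear_matrix_mult_right this, of M]
    integral_bounded_linear[OF bounded_linear_matrix_mult_left this, of M]
  have "M ** (indicator S t *\<^sub>R f t) = (indicator S t *\<^sub>R f t) ** M" for t
    using assms[of t] by (auto simp: indicator_def mcomm_def scaleR_matrix_mult_left scaleR_matrix_mult_right)
  with int show ?thesis
    by (simp add: mcomm_def set_lebesgue_integral_def)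
next
  case False
  then have "(LINT t:S|lborel. f t) = 0"
    by (simp add: set_lebesgue_integral_def set_integrable_def not_integrable_integral_eq)
  then show ?thesis
    by (simp add: mcomm_def bounded_bilinear.zero_left[OF bounded_bilinear_matrix_mult]
      bounded_bilinear.zero_right[OF bounded_bilinear_matrix_mult])
qed

text \<open>The scalar part acts as multiplication by the number \<open>j\<close> and contributes
  exactly \<open>j * norm X\<close>. Plain submultiplicativity would charge the Frobenius norm of
  \<open>mat (of_nat j)\<close>, which is sqrt r times larger, and this loss would accumulate over
  all factors of a Pochhammer product.\<close>

lemma norm_mult_add_mat_le: "norm (X ** (B + mat (of_nat j))) \<le> norm X * (norm B + of_nat j)"
  for X B :: "complex^'n^'n"
proof -
  have "X ** (B + mat (of_nat j)) = X ** B + real j *\<^sub>R X"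
    using mcomm_mat(1)[of X "of_real (real j)"] mat_of_real_mult[of "real j" X]
    by (simp add: matrix_add_ldistrib mcomm_def)
  then have "norm (X ** (B + mat (of_nat j))) \<le> norm (X ** B) + norm (real j *\<^sub>R X)"
    by (metis norm_triangle_ineq)
  also have "\<dots> \<le> norm X * norm B + real j * norm X"
    using norm_matrix_mult_le[of X B] by simp
  finally show ?thesis by (simp add: algebra_simps)
qed

lemma norm_mpochhammer_le: "norm (mpochhammer B k) \<le> norm (mat 1 :: complex^'n^'n) * pochhammer (norm B) k"
  for B :: "complex^'n^'n"
proof (induction k)
  case (Suc k)
  have "norm (mpochhammer B (Suc k)) \<le> norm (mpochhammer B k) * (norm B + of_nat k)"
    by (simp add: norm_mult_add_mat_le)
  also have "\<dots> \<le> norm (mat 1 :: complex^'n^'n) * pochhammer (norm B) k * (norm B + of_nat k)"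
    using Suc by (intro mult_right_mono) auto
  finally show ?case by (simp add: pochhammer_Suc algebra_simps)
qed simp

lemma norm_mpower_le: "norm (mpower M k) \<le> norm (mat 1 :: complex^'n^'n) * norm M ^ k"
  for M :: "complex^'n^'n"
proof (induction k)
  case (Suc k)
  have "norm (mpower M (Suc k)) \<le> norm (mpower M k) * norm M"
    by (simp add: norm_matrix_mult_le)
  also have "\<dots> \<le> norm (mat 1 :: complex^'n^'n) * norm M ^ k * norm M"
    using Suc by (intro mult_right_mono) auto
  finally show ?case by (simp add: algebra_simps)
qed simp

lemma mpower_scaleR: "mpower (c *\<^sub>R M) k = c ^ k *\<^sub>R mpower M k"
  by (induction k) (auto simp: scaleR_matrix_mult_left scaleR_matrix_mult_right)

section \<open>The matrix exponential\<close>

lemma summable_norm_mexp: "summable (\<lambda>k. norm ((1 / fact k) *\<^sub>R mpower M k))"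
  for M :: "complex^'n^'n"
proof (rule summable_comparison_test')
  show "summable (\<lambda>k. norm (mat 1 :: complex^'n^'n) * (norm M ^ k /\<^sub>R fact k))"
    using summable_exp_generic[of "norm M"] by (intro summable_mult) auto
  show "norm (norm ((1 / fact k) *\<^sub>R mpower M k)) \<le>
      norm (mat 1 :: complex^'n^'n) * (norm M ^ k /\<^sub>R fact k)" for k
    using norm_mpower_le[of M k] by (simp add: field_simps)
qed

lemma norm_mexp_le: "norm (mexp M) \<le> norm (mat 1 :: complex^'n^'n) * exp (norm M)"
  for M :: "complex^'n^'n"
proof -
  have "norm (mexp M) \<le> (\<Sum>k. norm ((1 / fact k) *\<^sub>R mpower M k))"
    unfolding mexp_def by (rule summable_norm[OF summable_norm_mexp])
  also have "\<dots> \<le> (\<Sum>k. norm (mat 1 :: complex^'n^'n) * (norm M ^ k /\<^sub>R fact k))"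
  proof (rule suminf_le[OF _ summable_norm_mexp])
    show "summable (\<lambda>k. norm (mat 1 :: complex^'n^'n) * (norm M ^ k /\<^sub>R fact k))"
      using summable_exp_generic[of "norm M"] by (intro summable_mult) auto
    show "norm ((1 / fact k) *\<^sub>R mpower M k) \<le>
        norm (mat 1 :: complex^'n^'n) * (norm M ^ k /\<^sub>R fact k)" for k
      using norm_mpower_le[of M k] by (simp add: field_simps)
  qed
  also have "\<dots> = norm (mat 1 :: complex^'n^'n) * exp (norm M)"
    unfolding exp_def using summable_exp_generic[of "norm M"] by (rule suminf_mult)
  finally show ?thesis .
qed

lemma mcomm_mexp: "mcomm M N \<Longrightarrow> mcomm M (mexp N)"
  unfolding mexp_def
  by (intro mcomm_suminf summable_norm_cancel[OF summable_norm_mexp] mcomm_scaleR mcomm_mpower)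

lemma mexp_0 [simp]: "mexp (0 :: complex^'n^'n) = mat 1"
proof -
  have zero: "mpower (0 :: complex^'n^'n) (Suc k) = 0" for k
    by (simp add: bounded_bilinear.zero_right[OF bounded_bilinear_matrix_mult])
  have "(1 / fact k) *\<^sub>R mpower (0 :: complex^'n^'n) k = (if k = 0 then mat 1 else 0)" for k
    using zero[of "k - 1"] by (cases k) auto
  then have "mexp (0 :: complex^'n^'n) = (\<Sum>k::nat. if k = 0 then mat 1 else 0)"
    by (simp only: mexp_def)
  also have "\<dots> = mat 1"
    by (subst suminf_finite[of "{0}"]) auto
  finally show ?thesis .
qed

section \<open>Differentiation of the exponential along a real line\<close>

definition matrix_unit :: "'n \<Rightarrow> 'n \<Rightarrow> complex \<Rightarrow> complex^'n^'n" where
  "matrix_unit i j c = axis i (axis j c)"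

lemma matrix_unit_nth: "matrix_unit i j c $ k $ l = (if k = i then if l = j then c else 0 else 0)"
  by (simp add: matrix_unit_def axis_def)

lemma bounded_linear_matrix_unit: "bounded_linear (matrix_unit i j)"
  unfolding linear_conv_bounded_linear[symmetric]
  by (rule linearI) (simp_all add: vec_eq_iff matrix_unit_nth)

lemma matrix_unit_sum: "(\<Sum>i\<in>UNIV. \<Sum>j\<in>UNIV. matrix_unit i j (M $ i $ j)) = M"
proof -
  have "(\<Sum>i\<in>UNIV. \<Sum>j\<in>UNIV. matrix_unit i j (M $ i $ j)) $ k $ l = M $ k $ l" for k l
  proof -
    have "(\<Sum>j\<in>UNIV. matrix_unit i j (M $ i $ j) $ k $ l) = (if k = i then M $ i $ l else 0)" for i
      by (simp add: matrix_unit_nth)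
    then show ?thesis by simp
  qed
  then show ?thesis by (simp add: vec_eq_iff)
qed

text \<open>A matrix is the finite sum of its entries placed by the bounded linear maps
  \<open>matrix_unit i j\<close>, so scalar derivatives of the entries assemble to a matrix
  derivative.\<close>

lemma has_vector_derivative_matrixI:
  fixes f :: "real \<Rightarrow> complex^'n^'n"
  assumes "\<And>i j. ((\<lambda>s. f s $ i $ j) has_vector_derivative f' $ i $ j) (at x)"
  shows "(f has_vector_derivative f') (at x)"
proof -
  have "((\<lambda>s. \<Sum>i\<in>UNIV. \<Sum>j\<in>UNIV. matrix_unit i j (f s $ i $ j)) has_vector_derivative
      (\<Sum>i\<in>UNIV. \<Sum>j\<in>UNIV. matrix_unit i j (f' $ i $ j))) (at x)"
    by (intro has_vector_derivative_sum
        bounded_linear.has_vector_derivative[OF bounded_linear_matrix_unit] assms)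
  then show ?thesis by (simp add: matrix_unit_sum)
qed

lemma bounded_linear_matrix_entry: "bounded_linear (\<lambda>M :: complex^'n^'m. M $ i $ j)"
  by (rule bounded_linear_compose[OF bounded_linear_vec_nth[of j] bounded_linear_vec_nth[of i]])

text \<open>Each entry of \<open>mexp (s *\<^sub>R M)\<close> is an everywhere convergent complex
  power series in \<open>s\<close>. It is differentiated termwise as such, and the derivative is
  then restricted to the real line.\<close>

lemma mexp_has_vector_derivative:
  "((\<lambda>s. mexp (s *\<^sub>R M)) has_vector_derivative (M ** mexp (s *\<^sub>R M))) (at s)"
  for M :: "complex^'n^'n"
proof (rule has_vector_derivative_matrixI)
  fix i j
  define c where "c k = mpower M k $ i $ j / fact k" for k
  have summand: "((1 / fact k) *\<^sub>R mpower (x *\<^sub>R M) k) $ i $ j = c k * of_real x ^ k" for k x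
    by (simp add: mpower_scaleR c_def scaleR_conv_of_real[where 'a = complex])
  have sum': "summable (\<lambda>k. (1 / fact k) *\<^sub>R mpower (x *\<^sub>R M) k)" for x
    by (rule summable_norm_cancel[OF summable_norm_mexp])
  have entry: "mexp (x *\<^sub>R M) $ i $ j = (\<Sum>k. c k * of_real x ^ k)" for x
    unfolding mexp_def summand[symmetric]
    by (rule bounded_linear.suminf[OF bounded_linear_matrix_entry sum'])
  have sum: "summable (\<lambda>k. c k * z ^ k)" for z
  proof (rule summable_norm_cancel, rule summable_comparison_test')
    show "summable (\<lambda>k. norm ((1 / fact k) *\<^sub>R mpower (norm z *\<^sub>R M) k))"
      by (rule summable_norm_mexp)
    show "norm (norm (c k * z ^ k)) \<le> norm ((1 / fact k) *\<^sub>R mpower (norm z *\<^sub>R M) k)" for k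
    proof -
      have "norm (c k * z ^ k) = norm (((1 / fact k) *\<^sub>R mpower (norm z *\<^sub>R M) k) $ i $ j)"
        unfolding summand by (simp add: norm_mult norm_power)
      also have "\<dots> \<le> norm (((1 / fact k) *\<^sub>R mpower (norm z *\<^sub>R M) k) $ i)"
        by (rule Finite_Cartesian_Product.norm_nth_le)
      also have "\<dots> \<le> norm ((1 / fact k) *\<^sub>R mpower (norm z *\<^sub>R M) k)"
        by (rule Finite_Cartesian_Product.norm_nth_le)
      finally show ?thesis by simp
    qed
  qed
  \<comment> \<open>The factor \<open>Suc k\<close> from differentiation cancels against
    \<open>fact (Suc k)\<close>, leaving one extra factor \<open>M\<close>, which commutes with the
    power and is moved to the left.\<close>
  have d: "diffs c k = (M ** mpower M k) $ i $ j / fact k" for k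
    using mcomm_mpower[of M M k] by (simp add: diffs_def c_def mcomm_def field_simps del: of_nat_Suc)
  have "(M ** mexp (s *\<^sub>R M)) $ i $ j = (\<Sum>k. (M ** ((1 / fact k) *\<^sub>R mpower (s *\<^sub>R M) k)) $ i $ j)"
    unfolding mexp_def
    by (subst bounded_linear.suminf[OF bounded_linear_matrix_mult_right sum'])
      (rule bounded_linear.suminf[OF bounded_linear_matrix_entry
        bounded_linear.summable[OF bounded_linear_matrix_mult_right sum']])
  also have "\<dots> = (\<Sum>k. diffs c k * of_real s ^ k)"
    by (simp add: d mpower_scaleR scaleR_matrix_mult_right scaleR_conv_of_real[where 'a = complex] mult_ac)
  finally have eq: "(M ** mexp (s *\<^sub>R M)) $ i $ j = (\<Sum>k. diffs c k * of_real s ^ k)" .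
  have "((\<lambda>z. \<Sum>k. c k * z ^ k) has_field_derivative (\<Sum>k. diffs c k * of_real s ^ k)) (at (of_real s))"
    by (rule termdiffs_strong_converges_everywhere[OF sum])
  from has_vector_derivative_real_field[OF this]
  show "((\<lambda>x. mexp (x *\<^sub>R M) $ i $ j) has_vector_derivative (M ** mexp (s *\<^sub>R M)) $ i $ j) (at s)"
    unfolding entry eq .
qed

lemma mexp_uminus_has_vector_derivative:
  "((\<lambda>s. mexp (- s *\<^sub>R M)) has_vector_derivative - (M ** mexp (- s *\<^sub>R M))) (at s)"
proof -
  have "(uminus has_vector_derivative (- 1)) (at s)"
    using has_vector_derivative_minus[OF has_vector_derivative_id, of "at s"] by simp
  from vector_diff_chain_at[OF this mexp_has_vector_derivative[of M "- s"]]
  show ?thesis by (simp add: o_def)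
qed

lemma constant_if_derivative_zero:
  fixes f :: "real \<Rightarrow> 'a :: real_normed_vector"
  assumes "\<And>x. (f has_vector_derivative 0) (at x)"
  shows "f x = f y"
proof -
  obtain c where "\<And>x. x \<in> UNIV \<Longrightarrow> f x = c"
    using has_vector_derivative_zero_constant[of UNIV f] assms by auto
  then show ?thesis by simp
qed

text \<open>The product has derivative 0 because \<open>M\<close> commutes with its exponential, so
  it keeps its value at \<open>s = 0\<close>. This avoids Cauchy products of matrix series.\<close>

lemma mexp_minus_inverse: "mexp (s *\<^sub>R M) ** mexp (- s *\<^sub>R M) = mat 1"
  for M :: "complex^'n^'n"
proof -
  have d2: "((\<lambda>s. mexp (- s *\<^sub>R M)) has_vector_derivative - (M ** mexp (- s *\<^sub>R M))) (at s)" for s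
    by (rule mexp_uminus_has_vector_derivative)
  have c: "M ** mexp (s *\<^sub>R M) = mexp (s *\<^sub>R M) ** M" for s
    using mcomm_mexp[OF mcomm_scaleR[OF mcomm_refl]] by (simp add: mcomm_def)
  have "((\<lambda>s. mexp (s *\<^sub>R M) ** mexp (- s *\<^sub>R M)) has_vector_derivative 0) (at s)" for s
    using bounded_bilinear.has_vector_derivative[OF bounded_bilinear_matrix_mult
        mexp_has_vector_derivative[of M s] d2[of s]]
    by (simp add: c bounded_bilinear.minus_right[OF bounded_bilinear_matrix_mult] matrix_mul_assoc)
  from constant_if_derivative_zero[of "\<lambda>s. mexp (s *\<^sub>R M) ** mexp (- s *\<^sub>R M)", OF this, of s 0]
  show ?thesis by simp
qed

text \<open>The function \<open>F\<close> solves F' = - c F, so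
  \<open>exp (s * c) *\<^sub>R F s\<close> is constant and equal to \<open>F 0 = mat 1\<close>;
  multiplying by \<open>mexp (s *\<^sub>R N)\<close> yields the claim.\<close>

lemma mexp_add_mat: "mexp (s *\<^sub>R (M + mat (of_real c))) = exp (s * c) *\<^sub>R mexp (s *\<^sub>R M)"
  for M :: "complex^'n^'n"
proof -
  define N where "N = M + mat (of_real c)"
  define F where "F s = mexp (s *\<^sub>R M) ** mexp (- s *\<^sub>R N)" for s
  have d2: "((\<lambda>s. mexp (- s *\<^sub>R N)) has_vector_derivative - (N ** mexp (- s *\<^sub>R N))) (at s)" for s
    by (rule mexp_uminus_has_vector_derivative)
  have comm: "M ** mexp (s *\<^sub>R M) = mexp (s *\<^sub>R M) ** M" for s
    using mcomm_mexp[OF mcomm_scaleR[OF mcomm_refl]] by (simp add: mcomm_def)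
  have N: "N ** X = M ** X + c *\<^sub>R X" for X
    by (simp add: N_def matrix_add_rdistrib' mat_of_real_mult)
  have "(F has_vector_derivative - (c *\<^sub>R F s)) (at s)" for s
    unfolding F_def
    using bounded_bilinear.has_vector_derivative[OF bounded_bilinear_matrix_mult
        mexp_has_vector_derivative[of M s] d2[of s]]
    by (simp add: N comm matrix_add_ldistrib bounded_bilinear.minus_right[OF bounded_bilinear_matrix_mult]
        matrix_mul_assoc scaleR_matrix_mult_right bounded_bilinear.diff_right[OF bounded_bilinear_matrix_mult])
  then have "((\<lambda>s. exp (s * c) *\<^sub>R F s) has_vector_derivative 0) (at s)" for s
    by (auto intro!: derivative_eq_intros simp: algebra_simps)
  from constant_if_derivative_zero[of "\<lambda>s. exp (s * c) *\<^sub>R F s", OF this, of s 0]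
  have "exp (s * c) *\<^sub>R F s = mat 1" by (simp add: F_def)
  then have "exp (s * c) *\<^sub>R F s ** mexp (s *\<^sub>R N) = mexp (s *\<^sub>R N)" by simp
  moreover have "F s ** mexp (s *\<^sub>R N) = mexp (s *\<^sub>R M)"
    using mexp_minus_inverse[of "- s" N] by (simp add: F_def matrix_mul_assoc[symmetric])
  ultimately show ?thesis
    by (simp add: N_def scaleR_matrix_mult_left)
qed

section \<open>Matrix powers of a positive real number\<close>

lemma mpowr_add_mat: "t > 0 \<Longrightarrow> mpowr t (M + mat (of_real c)) = t powr c *\<^sub>R mpowr t M"
  by (simp add: mpowr_def mexp_add_mat powr_def mult.commute)

lemma mpowr_diff_1:
  assumes "t > 0"
  shows "mpowr t (M - mat 1) = inverse t *\<^sub>R mpowr t M"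
proof -
  have "M - mat 1 = M + mat (of_real (- 1))"
    by (simp add: vec_eq_iff mat_def)
  then show ?thesis
    using mpowr_add_mat[OF assms, of M "- 1"] assms by (simp only: powr_minus_divide) (simp add: divide_inverse)
qed

lemma mpowr_has_vector_derivative:
  assumes "t > 0"
  shows "((\<lambda>t. mpowr t M) has_vector_derivative (M ** mpowr t (M - mat 1))) (at t)"
proof -
  have "(ln has_vector_derivative inverse t) (at t)"
    using assms has_real_derivative_iff_has_vector_derivative DERIV_ln by blast
  from vector_diff_chain_at[OF this mexp_has_vector_derivative[of M "ln t"]]
  have "((\<lambda>t. mpowr t M) has_vector_derivative inverse t *\<^sub>R (M ** mpowr t M)) (at t)"
    by (simp add: mpowr_def o_def)
  then show ?thesis
    by (simp add: mpowr_diff_1 assms scaleR_matrix_mult_right)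
qed

lemma bounded_linear_smult_left: "bounded_linear (\<lambda>c :: complex. c *s (y :: complex^'n))"
  unfolding linear_conv_bounded_linear[symmetric]
  by standard (auto simp: vec_eq_iff algebra_simps)

lemma mexp_eigenvector:
  assumes "M *v y = \<mu> *s y"
  shows "mexp M *v y = exp \<mu> *s y"
proof -
  have pow: "mpower M k *v y = \<mu> ^ k *s y" for k
    by (induction k)
      (simp_all add: assms matrix_vector_mul_assoc[symmetric] vec.scale)
  have "mexp M *v y = (\<Sum>k. ((1 / fact k) *\<^sub>R mpower M k) *v y)"
    unfolding mexp_def
    by (rule bounded_linear.suminf[OF bounded_linear_matrix_vector_mult_left])
      (rule summable_norm_cancel[OF summable_norm_mexp])
  also have "(\<lambda>k. ((1 / fact k) *\<^sub>R mpower M k) *v y) = (\<lambda>k. (\<mu> ^ k /\<^sub>R fact k) *s y)"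
    by (simp add: fun_eq_iff bounded_bilinear.scaleR_left[OF bounded_bilinear_matrix_vector_mult] pow
        vec_eq_iff divide_inverse_commute)
  also have "(\<Sum>k. (\<mu> ^ k /\<^sub>R fact k) *s y) = exp \<mu> *s y"
    unfolding exp_def
    by (rule bounded_linear.suminf[symmetric])
      (auto simp: summable_exp_generic bounded_linear_smult_left)
  finally show ?thesis .
qed

section \<open>Spectral induction\<close>

text \<open>This is p(M) x by Horner's scheme, evaluated directly on the vector, so that no
  polynomial in matrices has to be formed.\<close>

definition vec_poly :: "complex^'n^'n \<Rightarrow> complex poly \<Rightarrow> complex^'n \<Rightarrow> complex^'n" where
  "vec_poly M p x = fold_coeffs (\<lambda>a y. a *s x + M *v y) p 0"

lemma vec_poly_0 [simp]: "vec_poly M 0 x = 0"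
  by (simp add: vec_poly_def)

lemma vec_poly_pCons [simp]: "vec_poly M (pCons a p) x = a *s x + M *v vec_poly M p x"
  by (cases "p = 0 \<and> a = 0") (auto simp: vec_poly_def)

lemma vec_poly_add: "vec_poly M (p + q) x = vec_poly M p x + vec_poly M q x"
  by (induction p q rule: poly_induct2)
    (auto simp: matrix_vector_right_distrib vec.scale_left_distrib algebra_simps)

lemma vec_poly_smult: "vec_poly M (smult c p) x = c *s vec_poly M p x"
  by (induction p) (auto simp: vec.scale_right_distrib vec.scale vector_smult_assoc)

lemma vec_poly_sum: "vec_poly M (\<Sum>i\<in>I. p i) x = (\<Sum>i\<in>I. vec_poly M (p i) x)"
  by (induction I rule: infinite_finite_induct) (auto simp: vec_poly_add)

lemma vec_poly_monom: "vec_poly M (monom c i) x = c *s (mpower M i *v x)"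
proof -
  have comm: "mpower M i ** M = M ** mpower M i" for i
    using mcomm_mpower[of M M i] by (simp add: mcomm_def)
  show ?thesis
    by (induction i)
      (simp_all add: monom_0 monom_Suc vec.scale matrix_vector_mul_assoc comm)
qed

text \<open>The vectors M^i x for i from 0 to the dimension are one too many to be independent, and
  a dependence among them is a polynomial annihilating \<open>x\<close>. Dependence is a property of
  sets, so coinciding vectors are treated separately by a difference of two monomials.\<close>

lemma vec_poly_zero_exists: "\<exists>p. p \<noteq> 0 \<and> vec_poly M p x = 0"
  for M :: "complex^'n^'n"
proof -
  define v where "v i = mpower M i *v x" for i
  define I where "I = {..CARD('n)}"
  show ?thesis
  proof (cases "inj_on v I")
    case True
    then have "card (v ` I) = CARD('n) + 1"
      by (simp add: card_image I_def)
    then have "vec.dependent (v ` I)"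
      using vec.independent_card_le_dim[of "v ` I" UNIV] vec_dim_card[where 'a = complex and 'n = 'n]
      by (metis Suc_eq_plus1 Suc_n_not_le_n subset_UNIV)
    moreover have "finite (v ` I)"
      by (simp add: I_def)
    ultimately obtain u where u: "\<exists>y\<in>v ` I. u y \<noteq> 0" "(\<Sum>y\<in>v ` I. u y *s y) = 0"
      by (auto simp: vec.dependent_finite)
    define p where "p = (\<Sum>i\<in>I. monom (u (v i)) i)"
    have "vec_poly M p x = (\<Sum>i\<in>I. u (v i) *s v i)"
      by (simp add: p_def vec_poly_sum vec_poly_monom v_def)
    also have "\<dots> = 0"
      using u(2) by (simp add: sum.reindex[OF True])
    finally have "vec_poly M p x = 0" .
    moreover have "p \<noteq> 0"
    proof -
      obtain j where "j \<in> I" "u (v j) \<noteq> 0"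
        using u(1) by auto
      moreover have "coeff p j = (\<Sum>i\<in>I. if i = j then u (v i) else 0)"
        by (simp add: p_def coeff_sum)
      ultimately have "coeff p j \<noteq> 0"
        by (simp add: I_def)
      then show ?thesis by auto
    qed
    ultimately show ?thesis by blast
  next
    case False
    then obtain i j where ij: "v i = v j" "i \<noteq> j"
      by (auto simp: inj_on_def)
    define p where "p = monom 1 i + smult (- 1) (monom (1 :: complex) j)"
    have "coeff p i = 1"
      using ij by (simp add: p_def)
    then have "p \<noteq> 0" by auto
    moreover have "vec_poly M p x = v i + (- 1) *s v j"
      unfolding p_def vec_poly_add vec_poly_smult vec_poly_monom by (simp add: v_def)
    then have "vec_poly M p x = 0"
      using ij by (simp add: vec_eq_iff)
    ultimately show ?thesis by blast
  qed
qed

lemma vec_poly_linear_factor: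
  "vec_poly M ([:- \<mu>, 1:] * q) x = M *v vec_poly M q x - \<mu> *s vec_poly M q x"
proof -
  have "[:- \<mu>, 1:] * q = smult (- \<mu>) q + pCons 0 q"
    by simp
  then show ?thesis
    by (simp only: vec_poly_add vec_poly_smult vec_poly_pCons) (simp add: vec_eq_iff)
qed

lemma vec_poly_diff_eigen:
  "vec_poly M q (M *v x - \<mu> *s x) = M *v vec_poly M q x - \<mu> *s vec_poly M q x"
proof (induction q)
  case (pCons a q)
  then show ?case
    by (simp add: vec.scale vec.diff vec.add)
qed simp

text \<open>Peeling off one linear factor of a polynomial annihilating \<open>x\<close> replaces the Jordan
  decomposition in all later spectral arguments.\<close>

lemma eigenvalue_induct [case_names zero step]:
  fixes M :: "complex^'n^'n"
  assumes zero: "G 0"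
    and step: "\<And>\<mu> y x. y \<noteq> 0 \<Longrightarrow> M *v y = \<mu> *s y \<Longrightarrow> G (M *v x - \<mu> *s x) \<Longrightarrow> G x"
  shows "G x"
proof -
  have "G x" if "p \<noteq> 0" "degree p = n" "vec_poly M p x = 0" for n p x
    using that
  proof (induction n arbitrary: p x)
    case 0
    then obtain a where "p = [:a:]" "a \<noteq> 0"
      by (metis degree_eq_zeroE pCons_0_0)
    then have "x = 0"
      using 0 by (simp add: vec_eq_iff)
    then show ?case using zero by simp
  next
    case (Suc n)
    then obtain \<mu> where "poly p \<mu> = 0"
      using fundamental_theorem_of_algebra[of p] by (auto simp: constant_degree)
    then obtain q where q: "p = [:- \<mu>, 1:] * q"
      by (auto simp: poly_eq_0_iff_dvd dvd_def)
    with Suc.prems have q0: "q \<noteq> 0" by auto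
    then have "degree p = Suc (degree q)"
      unfolding q by (subst degree_mult_eq) auto
    then have deg: "degree q = n"
      using Suc.prems by simp
    have eq: "M *v vec_poly M q x - \<mu> *s vec_poly M q x = 0"
      using Suc.prems(3) by (simp only: q vec_poly_linear_factor)
    show ?case
    \<comment> \<open>Either \<open>q\<close>, of smaller degree, already annihilates
      \<open>x\<close>, or q(M) x is an eigenvector for \<open>\<mu>\<close>. In the second case
      \<open>q\<close> annihilates M x - \<open>\<mu>\<close> x, since q(M) commutes with M -
      \<open>\<mu>\<close> I; so the induction hypothesis supplies the premise of
      \<open>step\<close>.\<close>
    proof (cases "vec_poly M q x = 0")
      case True
      with Suc.IH q0 deg show ?thesis by blast
    next
      case False
      have "G (M *v x - \<mu> *s x)"
        using Suc.IH[OF q0 deg] eq by (simp add: vec_poly_diff_eigen)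
      then show ?thesis
        using step[OF False, of \<mu> x] eq by simp
    qed
  qed
  then show ?thesis
    using vec_poly_zero_exists[of M x] by blast
qed

section \<open>The Gamma matrix function\<close>

lemma positive_stable_eigenvalue: "positive_stable M \<Longrightarrow> M *v y = \<mu> *s y \<Longrightarrow> y \<noteq> 0 \<Longrightarrow> Re \<mu> > 0"
  by (auto simp: positive_stable_def)

lemma positive_stable_add_of_nat:
  assumes "positive_stable M"
  shows "positive_stable (M + mat (of_nat k))"
  unfolding positive_stable_def
proof (intro allI impI, elim conjE)
  fix \<mu> x
  assume x: "x \<noteq> 0" "(M + mat (of_nat k)) *v x = \<mu> *s x"
  then have "M *v x = (\<mu> - of_nat k) *s x"
    by (simp add: matrix_vector_mult_add_rdistrib mat_vector_mult vec_eq_iff algebra_simps)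
  from positive_stable_eigenvalue[OF assms this x(1)] show "Re \<mu> > 0" by simp
qed

lemma invertible_positive_stable:
  assumes "positive_stable M"
  shows "invertible M"
proof (rule invertible_if_kernel_trivial, rule ccontr)
  fix x assume "M *v x = 0" "x \<noteq> 0"
  with positive_stable_eigenvalue[OF assms, of x 0] show False by simp
qed

section \<open>Exponential decay of exp(-s P) for positive stable P\<close>

lemma bounded_bilinear_smult_vec: "bounded_bilinear (\<lambda>(c :: complex) (x :: complex^'n). c *s x)"
  by standard (auto simp: vec_eq_iff algebra_simps norm_smult_vec intro!: exI[of _ 1])

text \<open>Variation of constants: after multiplication by exp(s \<open>\<mu>\<close>), the
  derivative of exp(-s P) x involves only exp(-s P) z with z = P x - \<open>\<mu>\<close> x, whose
  decay is the induction hypothesis. Integrating the resulting bound from 0 to s gives the decay for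
  \<open>x\<close>.\<close>

lemma mexp_decay_vec:
  assumes "positive_stable P"
  shows "\<exists>\<epsilon> C. \<epsilon> > 0 \<and> (\<forall>s\<ge>0. norm (mexp (- s *\<^sub>R P) *v x) \<le> C * exp (- \<epsilon> * s))"
proof (induction x rule: eigenvalue_induct[where M = P])
  case zero
  show ?case
    by (intro exI[of _ 1] exI[of _ 0]) simp
next
  case (step \<mu> y x)
  define z where "z = P *v x - \<mu> *s x"
  have \<mu>: "Re \<mu> > 0"
    using positive_stable_eigenvalue[OF assms step(2,1)] .
  obtain \<epsilon> C where \<epsilon>: "\<epsilon> > 0"
    and C: "\<And>s. s \<ge> 0 \<Longrightarrow> norm (mexp (- s *\<^sub>R P) *v z) \<le> C * exp (- \<epsilon> * s)"
    using step(3) unfolding z_def by blast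
  have C0: "C \<ge> 0"
    using order_trans[OF norm_ge_zero C[of 0]] by simp
  \<comment> \<open>The rate is lowered to stay strictly below \<open>Re \<mu>\<close>. The bound on
    the derivative is then a growing exponential whose primitive \<open>\<phi>\<close> is again an
    exponential; with equality a factor s would appear.\<close>
  define \<delta> where "\<delta> = min \<epsilon> (Re \<mu> / 2)"
  have \<delta>: "\<delta> > 0" "\<delta> < Re \<mu>" "\<delta> \<le> \<epsilon>"
    using \<epsilon> \<mu> by (auto simp: \<delta>_def)
  define g where "g s = exp (of_real s * \<mu>) *s (mexp (- s *\<^sub>R P) *v x)" for s
  define g' where "g' s = - (exp (of_real s * \<mu>) *s (mexp (- s *\<^sub>R P) *v z))" for s
  define \<phi> where "\<phi> s = C / (Re \<mu> - \<delta>) * exp ((Re \<mu> - \<delta>) * s)" for s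
  have g: "(g has_vector_derivative g' s) (at s)" for s
  proof -
    have "((\<lambda>z. exp (z * \<mu>)) has_field_derivative (exp (of_real s * \<mu>) * \<mu>)) (at (of_real s))"
      by (auto intro!: derivative_eq_intros)
    from has_vector_derivative_real_field[OF this]
    have e: "((\<lambda>s. exp (of_real s * \<mu>)) has_vector_derivative (exp (of_real s * \<mu>) * \<mu>)) (at s)" .
    have m: "((\<lambda>s. mexp (- s *\<^sub>R P)) has_vector_derivative - (P ** mexp (- s *\<^sub>R P))) (at s)"
      by (rule mexp_uminus_has_vector_derivative)
    have v: "((\<lambda>s. mexp (- s *\<^sub>R P) *v x) has_vector_derivative - (P ** mexp (- s *\<^sub>R P)) *v x) (at s)"
      using bounded_linear.has_vector_derivative[OF bounded_linear_matrix_vector_mult_left m] .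
    have comm: "P ** mexp (- s *\<^sub>R P) = mexp (- s *\<^sub>R P) ** P"
      using mcomm_mexp[OF mcomm_scaleR[OF mcomm_refl]] by (simp only: mcomm_def)
    have rearrange: "c *s Y + (c * \<mu>) *s W = - (c *s Z)"
      if "Y = - X" "Z = X - \<mu> *s W" for c :: complex and W X Y Z :: "complex^'a"
      unfolding that by (simp add: vec_eq_iff algebra_simps)
    have "(- (P ** mexp (- s *\<^sub>R P))) *v x = - (mexp (- s *\<^sub>R P) *v (P *v x))"
      by (simp only: comm matrix_vector_mul_assoc bounded_bilinear.minus_left[OF bounded_bilinear_matrix_vector_mult])
    moreover have "mexp (- s *\<^sub>R P) *v z = mexp (- s *\<^sub>R P) *v (P *v x) - \<mu> *s (mexp (- s *\<^sub>R P) *v x)"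
      by (simp only: z_def vec.diff vec.scale)
    ultimately have "exp (of_real s * \<mu>) *s (- (P ** mexp (- s *\<^sub>R P)) *v x) +
        (exp (of_real s * \<mu>) * \<mu>) *s (mexp (- s *\<^sub>R P) *v x) = g' s"
      unfolding g'_def by (rule rearrange)
    then show ?thesis
      using bounded_bilinear.has_vector_derivative[OF bounded_bilinear_smult_vec e v]
      unfolding g_def by simp
  qed
  have \<phi>: "(\<phi> has_vector_derivative C * exp ((Re \<mu> - \<delta>) * s)) (at s)" for s
  proof -
    have "(\<phi> has_real_derivative C * exp ((Re \<mu> - \<delta>) * s)) (at s)"
      unfolding \<phi>_def using \<delta> by (auto intro!: derivative_eq_intros)
    then show ?thesis by (simp add: has_real_derivative_iff_has_vector_derivative)
  qed
  have bound: "norm (g' s) \<le> C * exp ((Re \<mu> - \<delta>) * s)" if "s \<ge> 0" for s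
  proof -
    have "norm (g' s) = exp (s * Re \<mu>) * norm (mexp (- s *\<^sub>R P) *v z)"
      by (simp add: g'_def norm_smult_vec)
    also have "\<dots> \<le> exp (s * Re \<mu>) * (C * exp (- \<delta> * s))"
    proof (rule mult_left_mono)
      have "C * exp (- \<epsilon> * s) \<le> C * exp (- \<delta> * s)"
        using C0 \<delta> that by (intro mult_left_mono) (auto intro: mult_right_mono)
      with C[OF that] show "norm (mexp (- s *\<^sub>R P) *v z) \<le> C * exp (- \<delta> * s)" by linarith
    qed simp
    also have "\<dots> = C * exp ((Re \<mu> - \<delta>) * s)"
      by (simp add: exp_add[symmetric] algebra_simps flip: exp_diff)
    finally show ?thesis .
  qed
  define D where "D = norm x + C / (Re \<mu> - \<delta>)"
  have "norm (mexp (- s *\<^sub>R P) *v x) \<le> D * exp (- \<delta> * s)" if "s \<ge> 0" for s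
  proof (cases "s = 0")
    case True
    then show ?thesis using C0 \<delta> by (simp add: D_def)
  next
    case False
    with that have "s > 0" by simp
    \<comment> \<open>Mean value inequality: the norm of \<open>g'\<close> is at most the derivative
      of the scalar function \<open>\<phi>\<close>.\<close>
    then have "norm (g s - g 0) \<le> \<phi> s - \<phi> 0"
    proof (rule differentiable_bound_general)
      show "continuous_on {0..s} g"
        by (intro continuous_at_imp_continuous_on ballI) (rule has_vector_derivative_continuous[OF g])
      show "continuous_on {0..s} \<phi>"
        by (intro continuous_at_imp_continuous_on ballI) (rule has_vector_derivative_continuous[OF \<phi>])
    qed (use g \<phi> bound in auto)
    moreover have "\<phi> 0 \<ge> 0"
      using C0 \<delta> by (simp add: \<phi>_def)
    moreover have "norm (g s) \<le> norm (g 0) + norm (g s - g 0)"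
      by (rule norm_triangle_sub)
    moreover have "g 0 = x"
      by (simp add: g_def vec_eq_iff)
    ultimately have "norm (g s) \<le> norm x + \<phi> s" by simp
    also have "\<dots> \<le> norm x * exp ((Re \<mu> - \<delta>) * s) + \<phi> s"
      using \<delta> that mult_left_mono[of 1 "exp ((Re \<mu> - \<delta>) * s)" "norm x"] by simp
    also have "\<dots> = D * exp ((Re \<mu> - \<delta>) * s)"
      by (simp add: D_def \<phi>_def algebra_simps)
    finally have "exp (s * Re \<mu>) * norm (mexp (- s *\<^sub>R P) *v x) \<le> exp (s * Re \<mu>) * (D * exp (- \<delta> * s))"
      by (simp add: g_def norm_smult_vec exp_add[symmetric] algebra_simps flip: exp_diff)
    then show ?thesis by simp
  qed
  with \<delta>(1) show ?case by blast
qed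

text \<open>A crude bound by the images of the unit vectors, each counted once per row; it turns
  decay on finitely many vectors into decay of the matrix.\<close>

lemma norm_matrix_le_sum_columns: "norm M \<le> (\<Sum>i\<in>(UNIV :: 'n set). \<Sum>j\<in>UNIV. norm (M *v axis j 1))"
  for M :: "complex^'n^'n"
proof -
  have "norm M \<le> (\<Sum>i\<in>UNIV. norm (M $ i))"
    by (simp add: norm_vec_def[of M] L2_set_le_sum)
  also have "\<dots> \<le> (\<Sum>i\<in>UNIV. \<Sum>j\<in>UNIV. norm (M $ i $ j))"
    by (intro sum_mono) (simp add: norm_vec_def L2_set_le_sum)
  also have "\<dots> \<le> (\<Sum>i\<in>(UNIV :: 'n set). \<Sum>j\<in>UNIV. norm (M *v axis j 1))"
  proof (intro sum_mono)
    fix i j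
    have "M $ i $ j = (M *v axis j 1) $ i"
      by (simp add: matrix_vector_mult_def axis_def if_distrib cong: if_cong)
    then show "norm (M $ i $ j) \<le> norm (M *v axis j 1)"
      by (metis Finite_Cartesian_Product.norm_nth_le)
  qed
  finally show ?thesis .
qed

lemma mexp_decay:
  fixes P :: "complex^'n^'n"
  assumes "positive_stable P"
  shows "\<exists>\<epsilon> C. \<epsilon> > 0 \<and> (\<forall>s\<ge>0. norm (mexp (- s *\<^sub>R P)) \<le> C * exp (- \<epsilon> * s))"
proof -
  from mexp_decay_vec[OF assms] obtain \<epsilon> C where
    *: "\<epsilon> x > 0" "s \<ge> 0 \<Longrightarrow> norm (mexp (- s *\<^sub>R P) *v x) \<le> C x * exp (- \<epsilon> x * s)" for x s
    by metis
  \<comment> \<open>Rate and constant depend on the vector; the least rate over the finitely many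
    unit vectors is still positive.\<close>
  define e where "e = Min (range (\<lambda>j :: 'n. \<epsilon> (axis j 1)))"
  have e: "e > 0" "e \<le> \<epsilon> (axis j 1)" for j :: 'n
    using * by (auto simp: e_def)
  have C0: "C x \<ge> 0" for x
    using order_trans[OF norm_ge_zero *(2)[of 0 x]] by simp
  define D where "D = (\<Sum>i\<in>(UNIV :: 'n set). \<Sum>j\<in>(UNIV :: 'n set). C (axis j 1))"
  have "norm (mexp (- s *\<^sub>R P)) \<le> D * exp (- e * s)" if "s \<ge> 0" for s
  proof -
    have "norm (mexp (- s *\<^sub>R P)) \<le> (\<Sum>i\<in>(UNIV :: 'n set). \<Sum>j\<in>UNIV. norm (mexp (- s *\<^sub>R P) *v axis j 1))"
      by (rule norm_matrix_le_sum_columns)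
    also have "\<dots> \<le> (\<Sum>i\<in>(UNIV :: 'n set). \<Sum>j\<in>(UNIV :: 'n set). C (axis j 1) * exp (- e * s))"
    proof (intro sum_mono)
      fix j :: 'n
      have "C (axis j 1) * exp (- \<epsilon> (axis j 1) * s) \<le> C (axis j 1) * exp (- e * s)"
        using C0 e(2)[of j] that by (intro mult_left_mono) (auto intro: mult_right_mono)
      then show "norm (mexp (- s *\<^sub>R P) *v axis j 1) \<le> C (axis j 1) * exp (- e * s)"
        using *(2)[OF that] order_trans by blast
    qed
    also have "\<dots> = D * exp (- e * s)"
      by (simp add: D_def sum_distrib_right)
    finally show ?thesis .
  qed
  with e(1) show ?thesis by blast
qed

text \<open>For t \<le> 1 put s = - ln t \<ge> 0: then t^P is exp(-s P), and its decay becomes a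
  positive power of t. For t > 1 the trivial bound by t to the power \<open>norm P\<close> suffices.
  The positive exponents give integrability near 0 and vanishing boundary values there.\<close>

lemma mpowr_bound:
  fixes P :: "complex^'n^'n"
  assumes "positive_stable P"
  shows "\<exists>a b C. a > 0 \<and> b > 0 \<and> C \<ge> 0 \<and> (\<forall>t>0. norm (mpowr t P) \<le> C * (t powr a + t powr b))"
proof -
  obtain \<epsilon> C where \<epsilon>: "\<epsilon> > 0"
    and C: "\<And>s. s \<ge> 0 \<Longrightarrow> norm (mexp (- s *\<^sub>R P)) \<le> C * exp (- \<epsilon> * s)"
    using mexp_decay[OF assms] by blast
  define D where "D = max C (norm (mat 1 :: complex^'n^'n))"
  \<comment> \<open>Adding \<open>\<epsilon>\<close> makes \<open>b > 0\<close> immediate; for t > 1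
    it only enlarges the bound.\<close>
  define b where "b = \<epsilon> + norm P"
  have D0: "D \<ge> 0" by (simp add: D_def le_max_iff_disj)
  have "norm (mpowr t P) \<le> D * (t powr \<epsilon> + t powr b)" if "t > 0" for t
  proof (cases "t \<le> 1")
    case True
    have "norm (mpowr t P) \<le> C * t powr \<epsilon>"
      using C[of "- ln t"] True that by (simp add: mpowr_def powr_def)
    also have "\<dots> \<le> D * (t powr \<epsilon> + t powr b)"
      using D0 by (intro mult_mono) (auto simp: D_def)
    finally show ?thesis .
  next
    case False
    have "norm (mpowr t P) \<le> norm (mat 1 :: complex^'n^'n) * t powr (norm P)"
      using norm_mexp_le[of "ln t *\<^sub>R P"] False by (simp add: mpowr_def powr_def mult.commute)
    also have "\<dots> \<le> D * t powr b"
      using D0 False \<epsilon> by (intro mult_mono powr_mono) (auto simp: D_def b_def)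
    also have "\<dots> \<le> D * (t powr \<epsilon> + t powr b)"
      using D0 by (intro mult_left_mono) auto
    finally show ?thesis .
  qed
  moreover have "b > 0" using \<epsilon> by (simp add: b_def add_pos_nonneg)
  ultimately show ?thesis using \<epsilon> D0 by blast
qed

section \<open>The Gamma integral and its functional equation\<close>

lemma set_integrable_Gamma_real:
  assumes "a > (0::real)"
  shows "set_integrable lborel {0<..} (\<lambda>t. exp (- t) * t powr (a - 1))"
proof -
  have "(\<lambda>t. t powr (a - 1) / exp t) absolutely_integrable_on {0..}"
    using has_integral_integrable[OF Gamma_integral_real[OF assms]]
    by (intro nonnegative_absolutely_integrable_1) auto
  then have "(\<lambda>t. t powr (a - 1) / exp t) absolutely_integrable_on {0<..}"
    by (rule set_integrable_subset) auto
  \<comment> \<open>Absolute integrability refers to the completed Lebesgue measure; Borel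
    measurability brings the statement back to \<open>lborel\<close>.\<close>
  moreover have "(\<lambda>t. indicator {0<..} t *\<^sub>R (t powr (a - 1) / exp t)) \<in> borel_measurable lborel"
    by measurable
  ultimately have "set_integrable lborel {0<..} (\<lambda>t. t powr (a - 1) / exp t)"
    unfolding set_integrable_def by (subst (asm) integrable_completion) auto
  then show ?thesis by (simp add: exp_minus field_simps)
qed

lemma continuous_on_mpowr: "continuous_on {0<..} (\<lambda>t. mpowr t M)"
  by (intro continuous_at_imp_continuous_on ballI
      has_vector_derivative_continuous[OF mpowr_has_vector_derivative]) auto

lemma set_integrable_mGamma:
  assumes "positive_stable P"
  shows "set_integrable lborel {0<..} (\<lambda>t. exp (- t) *\<^sub>R mpowr t (P - mat 1))"
proof -
  obtain a b C where ab: "a > 0" "b > 0" and C: "C \<ge> 0"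
    and bnd: "\<And>t. t > 0 \<Longrightarrow> norm (mpowr t P) \<le> C * (t powr a + t powr b)"
    using mpowr_bound[OF assms] by blast
  have "set_integrable lborel {0<..}
      (\<lambda>t. C * (exp (- t) * t powr (a - 1) + exp (- t) * t powr (b - 1)))"
    using ab by (intro set_integrable_mult_right set_integral_add set_integrable_Gamma_real) auto
  then show ?thesis
  proof (rule set_integrable_bound)
    show "set_borel_measurable lborel {0<..} (\<lambda>t. exp (- t) *\<^sub>R mpowr t (P - mat 1))"
      unfolding set_borel_measurable_def measurable_lborel2
      by (rule borel_measurable_continuous_on_indicator) (auto intro!: continuous_intros continuous_on_mpowr)
    have "norm (exp (- t) *\<^sub>R mpowr t (P - mat 1)) \<le>
        norm (C * (exp (- t) * t powr (a - 1) + exp (- t) * t powr (b - 1)))" if "t > 0" for t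
    proof -
      have "norm (exp (- t) *\<^sub>R mpowr t (P - mat 1)) = exp (- t) * (inverse t * norm (mpowr t P))"
        using that by (simp add: mpowr_diff_1)
      also have "\<dots> \<le> exp (- t) * (inverse t * (C * (t powr a + t powr b)))"
        using bnd[OF that] that by (intro mult_left_mono) auto
      also have "\<dots> = C * (exp (- t) * t powr (a - 1) + exp (- t) * t powr (b - 1))"
        using that by (simp add: powr_diff field_simps)
      finally show ?thesis by simp
    qed
    then show "AE t in lborel. t \<in> {0<..} \<longrightarrow> norm (exp (- t) *\<^sub>R mpowr t (P - mat 1)) \<le>
        norm (C * (exp (- t) * t powr (a - 1) + exp (- t) * t powr (b - 1)))" by auto
  qed
qed


lemma mGamma_add_1:
  assumes "positive_stable P"
  shows "mGamma (P + mat 1) = P ** mGamma P"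
proof -
  obtain a b C where ab: "a > 0" "b > 0" and C: "C \<ge> 0"
    and bnd: "\<And>t. t > 0 \<Longrightarrow> norm (mpowr t P) \<le> C * (t powr a + t powr b)"
    using mpowr_bound[OF assms] by blast
  have P1: "P + mat 1 - mat 1 = P" by simp
  have stable1: "positive_stable (P + mat 1)"
    using positive_stable_add_of_nat[OF assms, of 1] by simp
  \<comment> \<open>\<open>f\<close> is the derivative of \<open>F\<close>, and its integral over
    the half-line is P Gamma(P) - Gamma(P + I).\<close>
  define f where "f t = P ** (exp (- t) *\<^sub>R mpowr t (P - mat 1)) - exp (- t) *\<^sub>R mpowr t P" for t
  define F where "F t = exp (- t) *\<^sub>R mpowr t P" for t
  have int1: "set_integrable lborel {0<..} (\<lambda>t. exp (- t) *\<^sub>R mpowr t P)"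
    using set_integrable_mGamma[OF stable1] by (simp only: P1)
  have eq0: "P ** (LINT t:{0<..}|lborel. exp (- t) *\<^sub>R mpowr t (P - mat 1)) =
      (LINT t:{0<..}|lborel. P ** (exp (- t) *\<^sub>R mpowr t (P - mat 1)))"
    and int0: "set_integrable lborel {0<..} (\<lambda>t. P ** (exp (- t) *\<^sub>R mpowr t (P - mat 1)))"
    using integral_bounded_linear[OF bounded_linear_matrix_mult_right
        set_integrable_mGamma[OF assms, unfolded set_integrable_def], of P]
      integrable_bounded_linear[OF bounded_linear_matrix_mult_right
        set_integrable_mGamma[OF assms, unfolded set_integrable_def], of P]
    by (simp_all add: set_lebesgue_integral_def set_integrable_def scaleR_matrix_mult_right)
  have bndF: "norm (F t) \<le> C * (exp (- t) * t powr a) + C * (exp (- t) * t powr b)" if "t > 0" for t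
    using mult_left_mono[OF bnd[OF that], of "exp (- t)"] by (simp add: F_def algebra_simps)
  \<comment> \<open>The two zeros are the limits of \<open>F\<close> at 0 and at infinity. The first
    uses that both exponents in the bound are positive, the second that exp(-t) dominates any
    power.\<close>
  have "(LBINT t=0..\<infinity>. f t) = 0 - 0"
  proof (rule interval_integral_FTC_integrable)
    show "(F has_vector_derivative f t) (at t)" if "0 < ereal t" for t
    proof -
      have e: "((\<lambda>t. exp (- t)) has_real_derivative - exp (- t)) (at t)"
        by (auto intro!: derivative_eq_intros)
      have "(F has_vector_derivative exp (- t) *\<^sub>R (P ** mpowr t (P - mat 1)) + (- exp (- t)) *\<^sub>R mpowr t P) (at t)"
        unfolding F_def using that by (intro has_vector_derivative_scaleR[OF e] mpowr_has_vector_derivative) simp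
      then show ?thesis
        by (simp add: f_def scaleR_matrix_mult_right)
    qed
    have cont: "continuous_on {0<..} f"
      unfolding f_def
      by (intro continuous_intros bounded_linear.continuous_on[OF bounded_linear_matrix_mult_right]
          continuous_on_mpowr)
    show "isCont f t" if "0 < ereal t" for t
      using cont that by (simp add: continuous_on_eq_continuous_at)
    have "set_integrable lborel {0<..} f"
      unfolding f_def using int0 int1 by (rule set_integral_diff)
    then show "set_integrable lborel (einterval 0 \<infinity>) f"
      by (simp add: zero_ereal_def)
    have "((\<lambda>t. exp (- t) * t powr c) \<longlongrightarrow> 0) (at_right 0)" if "c > 0" for c :: real
      using that by real_asymp
    from tendsto_add[OF tendsto_mult_left[OF this[OF ab(1)], of C] tendsto_mult_left[OF this[OF ab(2)], of C]]
    have "((\<lambda>t. C * (exp (- t) * t powr a) + C * (exp (- t) * t powr b)) \<longlongrightarrow> 0) (at_right 0)"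
      by simp
    then have "(F \<longlongrightarrow> 0) (at_right 0)"
      by (rule Lim_null_comparison[rotated])
        (auto simp: eventually_at_filter bndF)
    then show "((F \<circ> real_of_ereal) \<longlongrightarrow> 0) (at_right 0)"
      by (simp add: zero_ereal_def ereal_tendsto_simps)
    have "((\<lambda>t. C * (exp (- t) * t powr a) + C * (exp (- t) * t powr b)) \<longlongrightarrow> 0) at_top"
      using ab by real_asymp
    then have "(F \<longlongrightarrow> 0) at_top"
      by (rule Lim_null_comparison[rotated])
        (rule eventually_mono[OF eventually_gt_at_top[of 0] bndF])
    then show "((F \<circ> real_of_ereal) \<longlongrightarrow> 0) (at_left \<infinity>)"
      by (simp add: ereal_tendsto_simps)
  qed simp
  then have "(LINT t:{0<..}|lborel. f t) = 0"
    by (simp add: interval_lebesgue_integral_0_infty)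
  then show ?thesis
    using set_integral_diff(2)[OF int0 int1] by (simp add: f_def mGamma_def eq0 P1)
qed

text \<open>On the eigenvector, t^(P - I) acts as the scalar t^(\<open>\<mu>\<close> - 1), so the
  matrix integral reduces to Euler's integral for \<open>Gamma \<mu>\<close>.\<close>

lemma mGamma_eigenvector:
  assumes "positive_stable P" "P *v y = \<mu> *s y" "y \<noteq> 0"
  shows "mGamma P *v y = Gamma \<mu> *s y"
proof -
  have \<mu>: "Re \<mu> > 0"
    using positive_stable_eigenvalue[OF assms] .
  define h where "h = (\<lambda>t. complex_of_real t powr (\<mu> - 1) / of_real (exp t))"
  have val: "(exp (- t) *\<^sub>R mpowr t (P - mat 1)) *v y = h t *s y" if "t > 0" for t
  proof -
    have "(ln t *\<^sub>R (P - mat 1)) *v y = (of_real (ln t) * (\<mu> - 1)) *s y"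
      using assms(2)
      by (simp add: bounded_bilinear.scaleR_left[OF bounded_bilinear_matrix_vector_mult]
          matrix_vector_mult_diff_rdistrib)
        (simp add: vec_eq_iff scaleR_conv_of_real[where 'a = complex] algebra_simps)
    from mexp_eigenvector[OF this]
    have "mpowr t (P - mat 1) *v y = (complex_of_real t powr (\<mu> - 1)) *s y"
      using that by (simp add: mpowr_def powr_def Ln_of_real mult.commute)
    then show ?thesis
      by (simp add: bounded_bilinear.scaleR_left[OF bounded_bilinear_matrix_vector_mult] h_def)
        (simp add: vec_eq_iff scaleR_conv_of_real[where 'a = complex] exp_minus field_simps)
  qed
  have int: "set_integrable lborel {0<..} h"
  proof -
    have "h absolutely_integrable_on {0<..}"
      unfolding h_def by (rule absolutely_integrable_Gamma_integral'[OF \<mu>])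
    moreover have "(\<lambda>t. indicator {0<..} t *\<^sub>R h t) \<in> borel_measurable lborel"
      unfolding measurable_lborel2 h_def
      by (rule borel_measurable_continuous_on_indicator) (auto intro!: continuous_intros)
    ultimately show ?thesis
      unfolding set_integrable_def by (subst (asm) integrable_completion) auto
  qed
  have "mGamma P *v y = (LINT t|lborel. (indicator {0<..} t *\<^sub>R exp (- t) *\<^sub>R mpowr t (P - mat 1)) *v y)"
    using integral_bounded_linear[OF bounded_linear_matrix_vector_mult_left
        set_integrable_mGamma[OF assms(1), unfolded set_integrable_def], of y]
    by (simp add: mGamma_def set_lebesgue_integral_def)
  also have "\<dots> = (LINT t|lborel. (indicator {0<..} t *\<^sub>R h t) *s y)"
    by (intro Bochner_Integration.integral_cong) (auto simp: val indicator_def)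
  also have "\<dots> = (LINT t:{0<..}|lborel. h t) *s y"
    using integral_bounded_linear[OF bounded_linear_smult_left int[unfolded set_integrable_def], of y]
    by (simp add: set_lebesgue_integral_def)
  also have "(LINT t:{0<..}|lborel. h t) = Gamma \<mu>"
    using set_borel_integral_eq_integral(2)[OF int] integral_unique[OF Gamma_integral_complex'[OF \<mu>]]
    by (simp add: h_def)
  finally show ?thesis .
qed

lemma mcomm_mpowr: "mcomm M N \<Longrightarrow> mcomm M (mpowr t N)"
  unfolding mpowr_def by (intro mcomm_mexp mcomm_scaleR)

lemma mcomm_mGamma: "mcomm M N \<Longrightarrow> mcomm M (mGamma N)"
  unfolding mGamma_def by (intro mcomm_set_integral mcomm_scaleR mcomm_mpowr mcomm_diff) auto

text \<open>The kernel is invariant under \<open>P\<close>. If \<open>x\<close> lies in it, so does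
  P x - \<open>\<mu>\<close> x, which vanishes by induction; hence a nonzero \<open>x\<close> would
  be an eigenvector, on which Gamma(P) acts as \<open>Gamma \<mu>\<close>. This scalar is nonzero:
  \<open>Gamma\<close> takes the value 0 only by convention at its poles, and
  \<open>Re \<mu> > 0\<close> excludes them.\<close>

lemma invertible_mGamma:
  assumes "positive_stable P"
  shows "invertible (mGamma P)"
proof (rule invertible_if_kernel_trivial)
  fix x assume "mGamma P *v x = 0"
  then show "x = 0"
  proof (induction x rule: eigenvalue_induct[where M = P])
    case (step \<mu> y x)
    have "mGamma P *v (P *v x) = P *v (mGamma P *v x)"
      using mcomm_mGamma[of P P] by (simp add: matrix_vector_mul_assoc mcomm_def)
    then have "mGamma P *v (P *v x - \<mu> *s x) = 0"
      using step.prems by (simp add: vec.diff vec.scale)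
    with step have eq: "P *v x = \<mu> *s x" by simp
    show ?case
    proof (rule ccontr)
      assume "x \<noteq> 0"
      with mGamma_eigenvector[OF assms eq] step.prems have "Gamma \<mu> = 0" by simp
      moreover have "Re \<mu> > 0"
        using positive_stable_eigenvalue[OF assms eq] \<open>x \<noteq> 0\<close> .
      ultimately show False
        by (auto simp: Gamma_eq_zero_iff elim!: nonpos_Ints_cases)
    qed
  qed simp
qed

section \<open>Beta matrix functions\<close>

lemma mGamma_add_of_nat:
  assumes "positive_stable P"
  shows "mGamma (P + mat (of_nat k)) = mpochhammer P k ** mGamma P"
proof (induction k)
  case 0
  have "mat 0 = (0 :: complex^'a^'a)"
    by (simp add: vec_eq_iff mat_def)
  then show ?case by simp
next
  case (Suc k)
  have "P + mat (of_nat (Suc k)) = P + mat (of_nat k) + mat 1"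
    by (simp add: mat_add add_ac)
  then have "mGamma (P + mat (of_nat (Suc k))) = (P + mat (of_nat k)) ** mGamma (P + mat (of_nat k))"
    by (simp only: mGamma_add_1[OF positive_stable_add_of_nat[OF assms]])
  also have "\<dots> = (P + mat (of_nat k)) ** mpochhammer P k ** mGamma P"
    by (simp add: Suc matrix_mul_assoc)
  also have "(P + mat (of_nat k)) ** mpochhammer P k = mpochhammer P k ** (P + mat (of_nat k))"
    using mcomm_add[OF mcomm_sym[OF mcomm_mpochhammer[OF mcomm_refl]] mcomm_mat(1), of P k "of_nat k"]
    by (simp add: mcomm_def)
  finally show ?case by simp
qed

lemma invertible_mpochhammer:
  assumes "positive_stable P"
  shows "invertible (mpochhammer P k)"
proof (induction k)
  case 0
  show ?case by (auto simp: invertible_def intro!: exI[of _ "mat 1"])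
next
  case (Suc k)
  then show ?case
    using invertible_positive_stable[OF positive_stable_add_of_nat[OF assms]]
    by (simp add: invertible_mult)
qed

lemma matrix_inv_inv: "invertible M \<Longrightarrow> matrix_inv (matrix_inv M) = M" for M :: "complex^'n^'n"
  by (rule matrix_inv_eqI) (auto simp: matrix_inv_invertible)

text \<open>The functional equation extracts (P)_k from Gamma(P + k I) and (P + Q)_k from Gamma(P +
  Q + k I). With P = \<open>A1\<close> and Q = \<open>C1 - A1\<close> this produces the factor
  (A1)_k (C1)_k^(-1) of the derivative formula.\<close>

lemma matrix_inv_mBeta_shift:
  assumes "positive_stable P" "positive_stable Q" "positive_stable (P + Q)" "mcomm P Q"
  shows "mpochhammer P k ** matrix_inv (mpochhammer (P + Q) k) **
      matrix_inv (mBeta (P + mat (of_nat k)) Q) = matrix_inv (mBeta P Q)"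
proof -
  define a c where "a = mpochhammer P k" and "c = mpochhammer (P + Q) k"
  define p q r where "p = mGamma P" and "q = mGamma Q" and "r = mGamma (P + Q)"
  have inv: "invertible a" "invertible c" "invertible p" "invertible q" "invertible r"
    using assms invertible_mpochhammer invertible_mGamma
    by (auto simp: a_def c_def p_def q_def r_def)
  have "P + mat (of_nat k) + Q = P + Q + mat (of_nat k)" by (simp add: add_ac)
  then have beta_k: "mBeta (P + mat (of_nat k)) Q = (a ** p) ** q ** matrix_inv (c ** r)"
    by (simp only: mBeta_def mGamma_add_of_nat[OF assms(1)] mGamma_add_of_nat[OF assms(3)]
        a_def c_def p_def q_def r_def)
  have beta: "mBeta P Q = p ** q ** matrix_inv r"
    by (simp add: mBeta_def p_def q_def r_def)
  define x where "x = r ** (matrix_inv q ** matrix_inv p)"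
  have inv_beta: "matrix_inv (mBeta P Q) = x"
    using inv by (simp add: beta x_def matrix_inv_mult matrix_inv_inv invertible_mult invertible_matrix_inv)
  \<comment> \<open>The order matters: \<open>c\<close> stands on the outside and cancels directly
    against its inverse, so the only commutation left is that of \<open>a\<close> with
    \<open>x\<close>.\<close>
  have inv_beta_k: "matrix_inv (mBeta (P + mat (of_nat k)) Q) = c ** x ** matrix_inv a"
    using inv by (simp add: beta_k x_def matrix_inv_mult matrix_inv_inv invertible_mult
        invertible_matrix_inv matrix_mul_assoc)
  have x: "mcomm M x" if "mcomm M P" "mcomm M Q" for M
    using that inv mcomm_add[OF that] unfolding x_def
    by (auto intro!: mcomm_mult mcomm_matrix_inv mcomm_mGamma simp: p_def q_def r_def)
  have "mcomm P x" "mcomm Q x"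
    using x[of P] x[of Q] assms(4) mcomm_sym by auto
  then have "mcomm x a"
    unfolding a_def by (intro mcomm_mpochhammer mcomm_sym[of P x])
  then have xa: "a ** x = x ** a" by (simp add: mcomm_def)
  have "a ** matrix_inv c ** (c ** x ** matrix_inv a) = a ** (matrix_inv c ** c) ** x ** matrix_inv a"
    by (simp only: matrix_mul_assoc)
  also have "\<dots> = x ** (a ** matrix_inv a)"
    by (simp only: matrix_inv_invertible[OF inv(2)] matrix_mul_rid xa matrix_mul_assoc)
  also have "\<dots> = x"
    using inv by (simp add: matrix_inv_invertible)
  finally show ?thesis
    by (simp only: inv_beta inv_beta_k a_def[symmetric] c_def[symmetric])
qed

section \<open>The confluent hypergeometric matrix series\<close>

lemma norm_matrix_inv_add_of_nat_le:
  fixes B :: "complex^'n^'n"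
  assumes "invertible (B + mat (of_nat k))"
  shows "norm (matrix_inv (B + mat (of_nat k))) * (real k - norm B) \<le> norm (mat 1 :: complex^'n^'n)"
proof -
  define X where "X = matrix_inv (B + mat (of_nat k))"
  have "mat 1 = X ** (B + mat (of_nat k))"
    using assms by (simp add: X_def matrix_inv_invertible)
  also have "\<dots> = X ** B + real k *\<^sub>R X"
    using mcomm_mat(1)[of X "of_real (real k)"] mat_of_real_mult[of "real k" X]
    by (simp add: matrix_add_ldistrib mcomm_def)
  \<comment> \<open>Taking norms here bounds k times \<open>norm X\<close> by
    \<open>norm (mat 1)\<close> plus \<open>norm X * norm B\<close>, so the inverse is of order
    1/k.\<close>
  finally have "real k *\<^sub>R X = mat 1 - X ** B"
    by (simp add: algebra_simps)
  then have "real k * norm X = norm (mat 1 - X ** B)"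
    by (metis abs_of_nat norm_scaleR)
  also have "\<dots> \<le> norm (mat 1 :: complex^'n^'n) + norm (X ** B)"
    by (rule norm_triangle_ineq4)
  also have "\<dots> \<le> norm (mat 1 :: complex^'n^'n) + norm X * norm B"
    by (intro add_left_mono norm_matrix_mult_le)
  finally show ?thesis by (simp add: X_def algebra_simps)
qed

text \<open>Ratio test for the scalar majorant \<open>u\<close>: the quotient of the Pochhammer and
  factorial factors stays bounded while the new inverse factor is of order 1/k. Convergence allows
  commutation to pass from the terms to the sum.\<close>

lemma summable_mhyp_1F1:
  fixes A B W :: "complex^'n^'n"
  assumes "positive_stable B"
  shows "summable (\<lambda>k. mpochhammer A k ** matrix_inv (mpochhammer B k) ** ((1 / fact k) *\<^sub>R mpower W k))"
proof -
  define e where "e = norm (mat 1 :: complex^'n^'n)"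
  define q where "q k = norm (matrix_inv (mpochhammer B k))" for k
  define b where "b k = norm (matrix_inv (B + mat (of_nat k)))" for k
  define u where "u k = pochhammer (norm A) k * q k * norm W ^ k / fact k" for k
  have e: "e \<ge> 0" by (simp add: e_def)
  have poch: "pochhammer (norm A) k \<ge> 0" for k
    by (induction k) (auto simp: pochhammer_Suc)
  have u0: "u k \<ge> 0" for k
    using poch by (simp add: u_def q_def)
  note inv = invertible_positive_stable[OF positive_stable_add_of_nat[OF assms]]
  have q: "q (Suc k) \<le> b k * q k" for k
    using norm_matrix_mult_le[of "matrix_inv (B + mat (of_nat k))" "matrix_inv (mpochhammer B k)"]
    by (simp add: q_def b_def matrix_inv_mult invertible_mpochhammer assms inv)
  \<comment> \<open>Chosen so that (norm A + 1) e norm W / (k - norm B) is at most 1/2 from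
    \<open>N\<close> on; the final 1 keeps the denominator positive.\<close>
  obtain N where N: "real N \<ge> norm B + 2 * ((norm A + 1) * (e * norm W)) + 1"
    using real_arch_simple by blast
  have "summable u"
  proof (rule summable_ratio_test[of "1 / 2" N])
    fix k assume "k \<ge> N"
    then have k: "real k - norm B \<ge> 2 * ((norm A + 1) * (e * norm W)) + 1"
      using N by linarith
    have pos: "real k - norm B > 0"
      using k e by (smt (verit) mult_nonneg_nonneg norm_ge_zero)
    have "b k \<le> e / (real k - norm B)"
      using norm_matrix_inv_add_of_nat_le[OF inv, of k] pos by (simp add: b_def e_def pos_le_divide_eq)
    moreover have "(norm A + k) / (1 + k) \<le> norm A + 1"
      by (simp add: pos_divide_le_eq algebra_simps)
    ultimately have "(norm A + k) / (1 + k) * (b k * norm W) \<le> (norm A + 1) * (e / (real k - norm B) * norm W)"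
      using pos e by (intro mult_mono) (auto simp: b_def)
    also have "\<dots> \<le> 1 / 2"
      using pos k by (simp add: field_simps)
    finally have ratio: "(norm A + k) / (1 + k) * (b k * norm W) \<le> 1 / 2" .
    have "u (Suc k) \<le> pochhammer (norm A) (Suc k) * (b k * q k) * norm W ^ Suc k / fact (Suc k)"
      unfolding u_def using q poch by (intro divide_right_mono mult_right_mono mult_left_mono) auto
    also have "\<dots> = (norm A + k) / (1 + k) * (b k * norm W) * u k"
      by (simp add: u_def pochhammer_Suc field_simps)
    also have "\<dots> \<le> 1 / 2 * u k"
      using ratio u0 by (rule mult_right_mono)
    finally show "norm (u (Suc k)) \<le> 1 / 2 * norm (u k)"
      using u0 by simp
  qed simp
  then have "summable (\<lambda>k. e\<^sup>2 * u k)"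
    by (rule summable_mult)
  then show ?thesis
  proof (rule summable_comparison_test')
    fix k
    have "norm (mpochhammer A k ** matrix_inv (mpochhammer B k) ** ((1 / fact k) *\<^sub>R mpower W k)) \<le>
        norm (mpochhammer A k) * q k * norm ((1 / fact k) *\<^sub>R mpower W k)"
      unfolding q_def by (intro order_trans[OF norm_matrix_mult_le] mult_right_mono norm_matrix_mult_le) auto
    also have "\<dots> \<le> (e * pochhammer (norm A) k) * q k * (1 / fact k * (e * norm W ^ k))"
      using norm_mpochhammer_le[of A k] norm_mpower_le[of W k] poch e
      by (intro mult_mono) (auto simp: e_def q_def divide_right_mono)
    also have "\<dots> = e\<^sup>2 * u k"
      by (simp add: u_def power2_eq_square)
    finally show "norm (mpochhammer A k ** matrix_inv (mpochhammer B k) ** ((1 / fact k) *\<^sub>R mpower W k))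
        \<le> e\<^sup>2 * u k" .
  qed
qed

lemma mcomm_mhyp_1F1:
  assumes "positive_stable B" "mcomm M A" "mcomm M B" "mcomm M W"
  shows "mcomm M (mhyp_1F1 A B W)"
  unfolding mhyp_1F1_def
  by (intro mcomm_suminf[OF summable_mhyp_1F1] mcomm_mult mcomm_mpochhammer mcomm_matrix_inv
      mcomm_scaleR mcomm_mpower invertible_mpochhammer assms)

lemma mcomm_ext_mBeta:
  assumes "positive_stable B" "mcomm M A" "mcomm M B" "mcomm M Y" "mcomm M P" "mcomm M Q"
  shows "mcomm M (ext_mBeta A B Y P Q)"
  unfolding ext_mBeta_def
  by (intro mcomm_set_integral mcomm_mult mcomm_mhyp_1F1 mcomm_mpowr mcomm_diff mcomm_uminus
      mcomm_scaleR mcomm_mat assms)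

text \<open>Passing from \<open>k\<close> to \<open>k + 1\<close> multiplies the integrand by \<open>t \<in> (0, 1)\<close>. So either no
  integrand is integrable, and all values are the junk value \<open>0\<close>, or all but finitely many are
  integrable with decreasing norm. The asymptotics of the confluent function are not needed.\<close>

lemma ext_mBeta_bounded:
  "\<exists>K. \<forall>k. norm (ext_mBeta A B Y (P + mat (of_nat k)) Q) \<le> K"
proof -
  define f where "f = (\<lambda>k t. indicator {0<..<1} t *\<^sub>R (mhyp_1F1 A B (- ((1 / (t * (1 - t))) *\<^sub>R Y))
      ** mpowr t (P + mat (of_nat k) - mat 1) ** mpowr (1 - t) (Q - mat 1)))"
  have E: "ext_mBeta A B Y (P + mat (of_nat k)) Q = integral\<^sup>L lborel (f k)" for k
    by (simp add: ext_mBeta_def set_lebesgue_integral_def f_def)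
  have f: "f (k + j) t = t ^ j *\<^sub>R f k t" for k j t
  proof (cases "t \<in> {0<..<1}")
    case True
    have shift: "P + mat (of_nat (k + j)) - mat 1 = P + mat (of_nat k) - mat 1 + mat (of_real (real j))"
      by (simp add: mat_add algebra_simps)
    have "mpowr t (P + mat (of_nat (k + j)) - mat 1) = t ^ j *\<^sub>R mpowr t (P + mat (of_nat k) - mat 1)"
      unfolding shift using mpowr_add_mat[of t "P + mat (of_nat k) - mat 1" "real j"] True by (simp add: powr_realpow)
    then show ?thesis
      using True by (simp add: f_def scaleR_matrix_mult_left scaleR_matrix_mult_right)
  qed (auto simp: f_def)
  show ?thesis
  proof (cases "\<exists>k. integrable lborel (f k)")
    case True
    then obtain k0 where k0: "integrable lborel (f k0)" by blast
    \<comment> \<open>The finite sum covers the indices below \<open>k0\<close>, integrable or not;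
      the L1 norm of \<open>f k0\<close> covers the rest.\<close>
    define K where "K = (\<Sum>k<k0. norm (integral\<^sup>L lborel (f k))) + (LINT t|lborel. norm (f k0 t))"
    have "norm (integral\<^sup>L lborel (f k)) \<le> K" for k
    proof (cases "k < k0")
      case True
      have "norm (integral\<^sup>L lborel (f k)) \<le> (\<Sum>k<k0. norm (integral\<^sup>L lborel (f k)))"
        using True by (intro member_le_sum) auto
      moreover have "(LINT t|lborel. norm (f k0 t)) \<ge> 0"
        by (intro integral_nonneg_AE) auto
      ultimately show ?thesis unfolding K_def by linarith
    next
      case False
      then obtain j where k: "k = k0 + j"
        using le_iff_add[of k0 k] by auto
      have bnd: "norm (f k t) \<le> norm (f k0 t)" for t
      proof (cases "t \<in> {0<..<1}")
        case True
        then have "\<bar>t\<bar> ^ j \<le> 1" by (intro power_le_one) auto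
        then show ?thesis
          using mult_right_mono[of "\<bar>t\<bar> ^ j" 1 "norm (f k0 t)"] by (simp add: k f power_abs)
      qed (auto simp: f_def)
      have meas: "f k0 \<in> borel_measurable lborel"
        using k0 by (rule borel_measurable_integrable)
      have "f k = (\<lambda>t. t ^ j *\<^sub>R f k0 t)"
        by (simp add: fun_eq_iff k f)
      also have "\<dots> \<in> borel_measurable lborel"
        using meas by measurable
      finally have "integrable lborel (f k)"
        using k0 bnd by (intro Bochner_Integration.integrable_bound[OF k0]) auto
      then have "(LINT t|lborel. norm (f k t)) \<le> (LINT t|lborel. norm (f k0 t))"
        using k0 bnd by (intro integral_mono) auto
      then have "norm (integral\<^sup>L lborel (f k)) \<le> (LINT t|lborel. norm (f k0 t))"
        by (rule order_trans[OF integral_norm_bound])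
      then show ?thesis
        by (simp add: K_def add_increasing sum_nonneg)
    qed
    then show ?thesis unfolding E by blast
  next
    case False
    then have "ext_mBeta A B Y (P + mat (of_nat k)) Q = 0" for k
      by (simp add: E not_integrable_integral_eq)
    then show ?thesis by (intro exI[of _ 0]) simp
  qed
qed

section \<open>Triple power series\<close>

lemma summable_pochhammer_power:
  assumes "a > (0::real)" "0 \<le> r" "r < 1"
  shows "summable (\<lambda>k. pochhammer a k / fact k * r ^ k)"
proof (cases "r = 0")
  case False
  with assms have r: "r > 0" by simp
  \<comment> \<open>Beyond \<open>N\<close> the quotient r (a + k) / (1 + k), which tends to r, lies
    below the midpoint (1 + r) / 2 of r and 1.\<close>
  obtain N where N: "real N > (r * a) / ((1 - r) / 2)"
    using reals_Archimedean2 by blast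
  show ?thesis
  proof (rule summable_ratio_test[of "(1 + r) / 2" N])
    show "(1 + r) / 2 < 1" using assms by simp
    fix k assume "k \<ge> N"
    then have "real k > (r * a) / ((1 - r) / 2)"
      using N by linarith
    then have "r * a < real k * ((1 - r) / 2)"
      using assms by (simp add: pos_divide_less_eq)
    then have "r * (a + k) \<le> (1 + r) / 2 * (1 + k)"
      using assms by (simp add: algebra_simps)
    then have ratio: "(a + k) / (1 + k) * r \<le> (1 + r) / 2"
      by (simp add: pos_divide_le_eq mult.commute)
    have nn: "pochhammer a k / fact k * r ^ k \<ge> 0" for k
      using assms pochhammer_nonneg[of a k] by simp
    have "norm (pochhammer a (Suc k) / fact (Suc k) * r ^ Suc k) =
        (a + k) / (1 + k) * r * (pochhammer a k / fact k * r ^ k)"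
      by (simp only: real_norm_def abs_of_nonneg[OF nn]) (simp add: pochhammer_Suc field_simps)
    also have "\<dots> \<le> (1 + r) / 2 * (pochhammer a k / fact k * r ^ k)"
      using ratio nn by (rule mult_right_mono)
    also have "\<dots> = (1 + r) / 2 * norm (pochhammer a k / fact k * r ^ k)"
      by (simp only: real_norm_def abs_of_nonneg[OF nn])
    finally show "norm (pochhammer a (Suc k) / fact (Suc k) * r ^ Suc k) \<le>
      (1 + r) / 2 * norm (pochhammer a k / fact k * r ^ k)" .
  qed
next
  case True
  then show ?thesis
    using summable_zero_power'[of "\<lambda>k. pochhammer a k / fact k"] by simp
qed

text \<open>The factorials are kept apart from the coefficient \<open>d\<close>, so that
  differentiating the series is a pure index shift of \<open>d\<close>.\<close>

definition triple_term :: "(nat \<Rightarrow> nat \<Rightarrow> nat \<Rightarrow> complex) \<Rightarrow> complex \<Rightarrow> complex \<Rightarrow> complex \<Rightarrow>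
    nat \<times> nat \<times> nat \<Rightarrow> complex" where
  "triple_term d z w v = (\<lambda>(m, n, p). d m n p * (z ^ m * w ^ n * v ^ p / (fact m * fact n * fact p)))"

definition triple_series :: "(nat \<Rightarrow> nat \<Rightarrow> nat \<Rightarrow> complex) \<Rightarrow> complex \<Rightarrow> complex \<Rightarrow> complex \<Rightarrow> complex" where
  "triple_series d z w v = infsum (triple_term d z w v) UNIV"

text \<open>A growth class that ensures convergence on the unit polydisc and is preserved by index
  shifts. A single parameter \<open>a\<close> for all three indices makes it symmetric under
  permuting them.\<close>

definition pochhammer_bounded :: "(nat \<Rightarrow> nat \<Rightarrow> nat \<Rightarrow> 'a :: real_normed_vector) \<Rightarrow> bool" where
  "pochhammer_bounded d \<longleftrightarrow> (\<exists>K a. a > 0 \<and>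
     (\<forall>m n p. norm (d m n p) \<le> K * (pochhammer a m * pochhammer a n * pochhammer a p)))"

lemma pochhammer_mono_real: "0 < a \<Longrightarrow> a \<le> b \<Longrightarrow> pochhammer a k \<le> pochhammer b k" for a :: real
  unfolding pochhammer_prod by (intro prod_mono) auto

text \<open>Since (a)_(m+1) = a (a + 1)_m, the shift costs a factor \<open>a\<close> in the constant
  and raises the parameter to \<open>a + 1\<close>, which the other two indices can also afford by
  monotonicity.\<close>

lemma pochhammer_bounded_shift1:
  assumes "pochhammer_bounded d"
  shows "pochhammer_bounded (\<lambda>m. d (Suc m))"
proof -
  obtain K a where a: "a > 0"
    and d: "norm (d m n p) \<le> K * (pochhammer a m * pochhammer a n * pochhammer a p)" for m n p
    using assms unfolding pochhammer_bounded_def by blast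
  have K: "K \<ge> 0"
    using order_trans[OF norm_ge_zero d[of 0 0 0]] by simp
  have "norm (d (Suc m) n p) \<le> (K * a) * (pochhammer (a + 1) m * pochhammer (a + 1) n * pochhammer (a + 1) p)"
    for m n p
  proof -
    have "pochhammer (a + 1) m * pochhammer a n * pochhammer a p \<le>
        pochhammer (a + 1) m * pochhammer (a + 1) n * pochhammer (a + 1) p"
      using a by (intro mult_mono pochhammer_mono_real mult_nonneg_nonneg pochhammer_nonneg) auto
    then have "K * a * (pochhammer (a + 1) m * pochhammer a n * pochhammer a p) \<le>
        K * a * (pochhammer (a + 1) m * pochhammer (a + 1) n * pochhammer (a + 1) p)"
      using K a by (intro mult_left_mono) auto
    then show ?thesis
      using d[of "Suc m" n p] by (simp add: pochhammer_rec mult_ac)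
  qed
  moreover have "a + 1 > 0" using a by simp
  ultimately show ?thesis
    unfolding pochhammer_bounded_def by blast
qed

lemma pochhammer_bounded_swap12: "pochhammer_bounded d \<Longrightarrow> pochhammer_bounded (\<lambda>m n p. d n m p)"
  unfolding pochhammer_bounded_def by (metis mult.commute)

lemma pochhammer_bounded_swap13: "pochhammer_bounded d \<Longrightarrow> pochhammer_bounded (\<lambda>m n p. d p n m)"
  unfolding pochhammer_bounded_def by (metis mult.commute mult.assoc)

lemma pochhammer_bounded_summable:
  fixes z w v :: complex
  assumes "pochhammer_bounded d" "norm z < 1" "norm w < 1" "norm v < 1"
  shows "(\<lambda>(m, n, p). norm (d m n p) *
    (norm z ^ m * norm w ^ n * norm v ^ p / (fact m * fact n * fact p))) summable_on UNIV"
proof -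
  obtain K a where a: "a > 0"
    and d: "norm (d m n p) \<le> K * (pochhammer a m * pochhammer a n * pochhammer a p)" for m n p
    using assms unfolding pochhammer_bounded_def by blast
  define g where "g r k = pochhammer a k / fact k * r ^ k" for r k
  have nn: "g r k \<ge> 0" if "r \<ge> 0" for r k
    using a that pochhammer_nonneg[OF a, of k] by (simp add: g_def)
  have g: "(\<lambda>k. g r k) summable_on UNIV" if "0 \<le> r" "r < 1" for r
    using summable_pochhammer_power[OF a that] nn[OF that(1)]
    by (intro norm_summable_imp_summable_on) (simp only: real_norm_def abs_of_nonneg g_def)
  \<comment> \<open>Used twice: once for the last two indices, once with a pair as second
    index.\<close>
  have prod: "(\<lambda>(x, y). f x * h y) summable_on UNIV \<times> UNIV"
    if "f summable_on UNIV" "h summable_on UNIV" "\<And>x. f x \<ge> 0" "\<And>y. h y \<ge> 0"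
    for f :: "nat \<Rightarrow> real" and h :: "'b \<Rightarrow> real"
  proof (rule summable_on_SigmaI)
    show "((\<lambda>y. case (x, y) of (x, y) \<Rightarrow> f x * h y) has_sum f x * infsum h UNIV) UNIV" for x
      using has_sum_cmult_right[OF has_sum_infsum[OF that(2)], of "f x"] by simp
    show "(\<lambda>x. f x * infsum h UNIV) summable_on UNIV"
      using that(1) by (rule summable_on_cmult_left)
  qed (use that in auto)
  have g2: "(\<lambda>(n, p). g (norm w) n * g (norm v) p) summable_on UNIV \<times> UNIV"
    using g[of "norm w"] g[of "norm v"] assms nn by (intro prod) auto
  have "(\<lambda>(m, q). g (norm z) m * (case q of (n, p) \<Rightarrow> g (norm w) n * g (norm v) p)) summable_on UNIV \<times> UNIV"
    using g[of "norm z"] g2 assms nn by (intro prod) (auto simp: case_prod_unfold)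
  then have "(\<lambda>q. K * (case q of (m, n, p) \<Rightarrow> g (norm z) m * (g (norm w) n * g (norm v) p))) summable_on UNIV"
    by (intro summable_on_cmult_right) (simp add: case_prod_unfold)
  then show ?thesis
  proof (rule summable_on_comparison_test)
    fix q :: "nat \<times> nat \<times> nat"
    obtain m n p where q: "q = (m, n, p)" by (cases q)
    have "norm (d m n p) * (norm z ^ m * norm w ^ n * norm v ^ p / (fact m * fact n * fact p)) \<le>
        K * (pochhammer a m * pochhammer a n * pochhammer a p) *
        (norm z ^ m * norm w ^ n * norm v ^ p / (fact m * fact n * fact p))"
      by (intro mult_right_mono d) auto
    then show "(case q of (m, n, p) \<Rightarrow> norm (d m n p) *
        (norm z ^ m * norm w ^ n * norm v ^ p / (fact m * fact n * fact p))) \<le>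
        K * (case q of (m, n, p) \<Rightarrow> g (norm z) m * (g (norm w) n * g (norm v) p))"
      by (simp add: q g_def field_simps)
  qed (auto intro!: mult_nonneg_nonneg)
qed

lemma triple_term_summable:
  assumes "pochhammer_bounded d" "norm z < 1" "norm w < 1" "norm v < 1"
  shows "triple_term d z w v summable_on UNIV"
  by (rule Infinite_Sum.abs_summable_summable,
      rule Infinite_Sum.abs_summable_on_comparison_test'[OF pochhammer_bounded_summable[OF assms]])
    (auto simp: triple_term_def norm_mult norm_divide norm_power)

text \<open>Summing over the last two indices first leaves an ordinary power series in
  \<open>z\<close>, to which termwise differentiation in one variable applies; absolute summability
  justifies the iteration.\<close>

lemma triple_series_as_power_series:
  assumes "pochhammer_bounded d" "norm z < 1" "norm w < 1" "norm v < 1"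
  defines "c \<equiv> (\<lambda>m. (\<Sum>\<^sub>\<infinity>(n, p)\<in>UNIV. d m n p * (w ^ n * v ^ p / (fact n * fact p))) / fact m)"
  shows "summable (\<lambda>m. c m * z ^ m)" "triple_series d z w v = (\<Sum>m. c m * z ^ m)"
proof -
  have eq: "(\<Sum>\<^sub>\<infinity>q. triple_term d z w v (m, q)) = c m * z ^ m" for m
  proof -
    have "(\<Sum>\<^sub>\<infinity>q. triple_term d z w v (m, q)) =
        (\<Sum>\<^sub>\<infinity>q. z ^ m / fact m * (case q of (n, p) \<Rightarrow> d m n p * (w ^ n * v ^ p / (fact n * fact p))))"
      by (intro infsum_cong) (auto simp: triple_term_def field_simps)
    then show ?thesis
      by (simp only: infsum_cmult_right') (simp add: c_def)
  qed
  have s: "triple_term d z w v summable_on UNIV \<times> UNIV"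
    using triple_term_summable[OF assms(1-4)] by simp
  have "(\<lambda>m. \<Sum>\<^sub>\<infinity>q. triple_term d z w v (m, q)) summable_on UNIV"
    using summable_on_Sigma_banach[of "\<lambda>m q. triple_term d z w v (m, q)"] s by simp
  then have sum: "(\<lambda>m. c m * z ^ m) summable_on UNIV"
    by (simp add: eq)
  then show "summable (\<lambda>m. c m * z ^ m)"
    by (rule summable_on_imp_summable)
  have "triple_series d z w v = (\<Sum>\<^sub>\<infinity>m. c m * z ^ m)"
    using infsum_Sigma_banach[OF s] by (simp add: triple_series_def eq)
  then show "triple_series d z w v = (\<Sum>m. c m * z ^ m)"
    using has_sum_imp_sums[OF has_sum_infsum[OF sum]] by (simp add: sums_iff)
qed

lemma triple_series_deriv1:
  assumes "pochhammer_bounded d" "norm z < 1" "norm w < 1" "norm v < 1"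
  shows "((\<lambda>x. triple_series d x w v) has_field_derivative triple_series (\<lambda>m. d (Suc m)) z w v) (at z)"
proof -
  define c where "c d m = (\<Sum>\<^sub>\<infinity>(n, p)\<in>UNIV. d m n p * (w ^ n * v ^ p / (fact n * fact p))) / fact m"
    for d :: "nat \<Rightarrow> nat \<Rightarrow> nat \<Rightarrow> complex" and m
  note ps = triple_series_as_power_series[OF assms(1) _ assms(3,4), folded c_def]
  \<comment> \<open>The factor m + 1 from differentiation turns 1/(m + 1)! into 1/m!.\<close>
  have "diffs (c d) = c (\<lambda>m. d (Suc m))"
    by (auto simp: diffs_def c_def fun_eq_iff field_simps simp del: of_nat_Suc)
  then have "triple_series (\<lambda>m. d (Suc m)) z w v = (\<Sum>m. diffs (c d) m * z ^ m)"
    using triple_series_as_power_series(2)[OF pochhammer_bounded_shift1[OF assms(1)] assms(2-4)]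
    by (simp only: c_def)
  moreover have "((\<lambda>x. \<Sum>m. c d m * x ^ m) has_field_derivative (\<Sum>m. diffs (c d) m * z ^ m)) (at z)"
    using ps(1) assms(2) by (rule termdiffs_strong')
  ultimately have "((\<lambda>x. \<Sum>m. c d m * x ^ m) has_field_derivative triple_series (\<lambda>m. d (Suc m)) z w v) (at z)"
    by simp
  then show ?thesis
    by (rule has_field_derivative_transform_within_open[of _ _ _ "ball 0 1"])
      (use assms(2) ps(2) in auto)
qed

text \<open>By this symmetry the derivatives in the other variables reduce to the one in the
  first.\<close>

lemma triple_series_swap12: "triple_series d z w v = triple_series (\<lambda>m n p. d n m p) w z v"
  unfolding triple_series_def
  by (rule infsum_reindex_bij_witness[of _ "\<lambda>(m, n, p). (n, m, p)" "\<lambda>(m, n, p). (n, m, p)"])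
    (auto simp: triple_term_def mult_ac)

lemma triple_series_swap13: "triple_series d z w v = triple_series (\<lambda>m n p. d p n m) v w z"
  unfolding triple_series_def
  by (rule infsum_reindex_bij_witness[of _ "\<lambda>(m, n, p). (p, n, m)" "\<lambda>(m, n, p). (p, n, m)"])
    (auto simp: triple_term_def mult_ac)

lemma triple_series_deriv2:
  assumes "pochhammer_bounded d" "norm z < 1" "norm w < 1" "norm v < 1"
  shows "((\<lambda>x. triple_series d z x v) has_field_derivative
    triple_series (\<lambda>m n. d m (Suc n)) z w v) (at w)"
  using triple_series_deriv1[OF pochhammer_bounded_swap12[OF assms(1)] assms(3,2,4)]
  by (simp add: triple_series_swap12[of d] triple_series_swap12[of "\<lambda>m n. d m (Suc n)"])

lemma triple_series_deriv3:
  assumes "pochhammer_bounded d" "norm z < 1" "norm w < 1" "norm v < 1"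
  shows "((\<lambda>x. triple_series d z w x) has_field_derivative
    triple_series (\<lambda>m n p. d m n (Suc p)) z w v) (at v)"
  using triple_series_deriv1[OF pochhammer_bounded_swap13[OF assms(1)] assms(4,3,2)]
  by (simp add: triple_series_swap13[of d] triple_series_swap13[of "\<lambda>m n p. d m n (Suc p)"])

section \<open>Matrix-valued triple series\<close>

definition matrix_triple_series :: "(nat \<Rightarrow> nat \<Rightarrow> nat \<Rightarrow> complex^'n^'n) \<Rightarrow>
    complex \<Rightarrow> complex \<Rightarrow> complex \<Rightarrow> complex^'n^'n" where
  "matrix_triple_series D z w v =
     (\<Sum>\<^sub>\<infinity>(m, n, p)\<in>UNIV. D m n p ** mat (z ^ m * w ^ n * v ^ p / (fact m * fact n * fact p)))"

lemma matrix_triple_series_summable: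
  fixes D :: "nat \<Rightarrow> nat \<Rightarrow> nat \<Rightarrow> complex^'n^'n"
  assumes "pochhammer_bounded D" "norm z < 1" "norm w < 1" "norm v < 1"
  shows "(\<lambda>(m, n, p). D m n p ** mat (z ^ m * w ^ n * v ^ p / (fact m * fact n * fact p))) summable_on UNIV"
proof (rule Infinite_Sum.abs_summable_summable,
    rule Infinite_Sum.abs_summable_on_comparison_test'[OF pochhammer_bounded_summable[OF assms]])
  have "norm (M ** mat c) = norm M * norm c" for M :: "complex^'n^'n" and c
    by (simp add: mat_mult_right norm_vec_def norm_mult L2_set_left_distrib)
  then show "norm (case q of (m, n, p) \<Rightarrow> D m n p ** mat (z ^ m * w ^ n * v ^ p / (fact m * fact n * fact p)))
      \<le> (case q of (m, n, p) \<Rightarrow> norm (D m n p) *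
        (norm z ^ m * norm w ^ n * norm v ^ p / (fact m * fact n * fact p)))" for q
    by (cases q) (simp add: norm_mult norm_divide norm_power)
qed

lemma matrix_triple_series_entry:
  fixes D :: "nat \<Rightarrow> nat \<Rightarrow> nat \<Rightarrow> complex^'n^'n"
  assumes "pochhammer_bounded D" "norm z < 1" "norm w < 1" "norm v < 1"
  shows "matrix_triple_series D z w v $ i $ j = triple_series (\<lambda>m n p. D m n p $ i $ j) z w v"
proof -
  have "matrix_triple_series D z w v $ i $ j =
      (\<Sum>\<^sub>\<infinity>q. (case q of (m, n, p) \<Rightarrow>
        D m n p ** mat (z ^ m * w ^ n * v ^ p / (fact m * fact n * fact p))) $ i $ j)"
    unfolding matrix_triple_series_def
    by (rule infsumI[OF has_sum_bounded_linear[OF bounded_linear_matrix_entry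
            has_sum_infsum[OF matrix_triple_series_summable[OF assms]]], symmetric])
  also have "\<dots> = triple_series (\<lambda>m n p. D m n p $ i $ j) z w v"
    unfolding triple_series_def
    by (intro infsum_cong) (auto simp: triple_term_def mat_mult_right)
  finally show ?thesis .
qed

text \<open>\<open>X \<mapsto> M ** X ** N\<close> is bounded linear and passes through the
  convergent sum; only the scalar matrix has to move past \<open>N\<close>, so \<open>M\<close> and
  \<open>N\<close> may be arbitrary.\<close>

lemma matrix_triple_series_mult:
  fixes D :: "nat \<Rightarrow> nat \<Rightarrow> nat \<Rightarrow> complex^'n^'n" and M N :: "complex^'n^'n"
  assumes "pochhammer_bounded D" "norm z < 1" "norm w < 1" "norm v < 1"
  shows "matrix_triple_series (\<lambda>m n p. M ** D m n p ** N) z w v = M ** matrix_triple_series D z w v ** N"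
proof -
  let ?T = "\<lambda>(m, n, p). D m n p ** mat (z ^ m * w ^ n * v ^ p / (fact m * fact n * fact p))"
  have lin: "bounded_linear (\<lambda>X. M ** X ** N)"
    using bounded_linear_compose[OF bounded_linear_matrix_mult_left[of N] bounded_linear_matrix_mult_right[of M]] .
  have comm: "X ** N ** mat c = X ** mat c ** N" for X :: "complex^'n^'n" and c
    using mcomm_mat(1)[of N c] by (simp add: mcomm_def matrix_mul_assoc[symmetric])
  have "matrix_triple_series (\<lambda>m n p. M ** D m n p ** N) z w v = (\<Sum>\<^sub>\<infinity>q. M ** ?T q ** N)"
    unfolding matrix_triple_series_def
    by (intro infsum_cong) (auto simp: comm matrix_mul_assoc)
  also have "\<dots> = M ** infsum ?T UNIV ** N"
    by (rule infsumI[OF has_sum_bounded_linear[OF lin has_sum_infsum[OF matrix_triple_series_summable[OF assms]]]])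
  finally show ?thesis
    by (simp add: matrix_triple_series_def)
qed

lemma pochhammer_bounded_entry:
  "pochhammer_bounded D \<Longrightarrow> pochhammer_bounded (\<lambda>m n p. D m n p $ i $ j)"
  for D :: "nat \<Rightarrow> nat \<Rightarrow> nat \<Rightarrow> complex^'n^'n"
  unfolding pochhammer_bounded_def
  by (meson Finite_Cartesian_Product.norm_nth_le order_trans)

lemma pochhammer_bounded_shift2: "pochhammer_bounded d \<Longrightarrow> pochhammer_bounded (\<lambda>m n. d m (Suc n))"
  using pochhammer_bounded_swap12[OF pochhammer_bounded_shift1[OF pochhammer_bounded_swap12]] .

lemma pochhammer_bounded_shift3: "pochhammer_bounded d \<Longrightarrow> pochhammer_bounded (\<lambda>m n p. d m n (Suc p))"
  using pochhammer_bounded_swap13[OF pochhammer_bounded_shift1[OF pochhammer_bounded_swap13]] .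

lemma pochhammer_bounded_shift:
  assumes "pochhammer_bounded d"
  shows "pochhammer_bounded (\<lambda>m n p. d (m + i) (n + j) (p + k))"
proof -
  have 1: "pochhammer_bounded (\<lambda>m. d (m + i))" if "pochhammer_bounded d" for i and d :: "nat \<Rightarrow> nat \<Rightarrow> nat \<Rightarrow> 'a"
    by (induction i) (use that pochhammer_bounded_shift1 in fastforce)+
  have 2: "pochhammer_bounded (\<lambda>m n. d m (n + i))" if "pochhammer_bounded d" for i and d :: "nat \<Rightarrow> nat \<Rightarrow> nat \<Rightarrow> 'a"
    by (induction i) (use that pochhammer_bounded_shift2 in fastforce)+
  have 3: "pochhammer_bounded (\<lambda>m n p. d m n (p + i))" if "pochhammer_bounded d" for i and d :: "nat \<Rightarrow> nat \<Rightarrow> nat \<Rightarrow> 'a"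
    by (induction i) (use that pochhammer_bounded_shift3 in fastforce)+
  show ?thesis
    using 1[OF 2[OF 3[OF assms]]] .
qed

section \<open>Differentiation of the Lauricella function\<close>

text \<open>Agreement is required on the open unit polydisc only; this already determines
  derivatives there, so the relation can be iterated through partial derivatives.\<close>

definition represented_by :: "(complex \<Rightarrow> complex \<Rightarrow> complex \<Rightarrow> complex^'n^'n) \<Rightarrow>
    (nat \<Rightarrow> nat \<Rightarrow> nat \<Rightarrow> complex^'n^'n) \<Rightarrow> bool" where
  "represented_by f D \<longleftrightarrow> (\<forall>z w v. norm z < 1 \<longrightarrow> norm w < 1 \<longrightarrow> norm v < 1 \<longrightarrow>
     f z w v = matrix_triple_series D z w v)"

lemma represented_by_partial1:
  assumes "represented_by f D" "pochhammer_bounded D"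
  shows "represented_by (partial1 f) (\<lambda>m. D (Suc m))"
    and "\<And>z w v i j. norm z < 1 \<Longrightarrow> norm w < 1 \<Longrightarrow> norm v < 1 \<Longrightarrow>
      (\<lambda>x. f x w v $ i $ j) field_differentiable (at z)"
proof -
  have der: "((\<lambda>x. f x w v $ i $ j) has_field_derivative matrix_triple_series (\<lambda>m. D (Suc m)) z w v $ i $ j) (at z)"
    if "norm z < 1" "norm w < 1" "norm v < 1" for z w v i j
  proof -
    have "((\<lambda>x. triple_series (\<lambda>m n p. D m n p $ i $ j) x w v) has_field_derivative
        matrix_triple_series (\<lambda>m. D (Suc m)) z w v $ i $ j) (at z)"
      using triple_series_deriv1[OF pochhammer_bounded_entry[OF assms(2)] that]
      by (simp add: matrix_triple_series_entry[OF pochhammer_bounded_shift1[OF assms(2)] that])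
    then show ?thesis
      by (rule has_field_derivative_transform_within_open[of _ _ _ "ball 0 1"])
        (use that assms in \<open>auto simp: represented_by_def matrix_triple_series_entry\<close>)
  qed
  show "represented_by (partial1 f) (\<lambda>m. D (Suc m))"
    by (auto simp: represented_by_def partial1_def vec_eq_iff DERIV_imp_deriv[OF der])
  show "(\<lambda>x. f x w v $ i $ j) field_differentiable (at z)"
    if "norm z < 1" "norm w < 1" "norm v < 1" for z w v i j
    using der[OF that] by (auto simp: field_differentiable_def)
qed

lemma represented_by_partial2:
  assumes "represented_by f D" "pochhammer_bounded D"
  shows "represented_by (partial2 f) (\<lambda>m n. D m (Suc n))"
    and "\<And>z w v i j. norm z < 1 \<Longrightarrow> norm w < 1 \<Longrightarrow> norm v < 1 \<Longrightarrow>
      (\<lambda>x. f z x v $ i $ j) field_differentiable (at w)"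
proof -
  have der: "((\<lambda>x. f z x v $ i $ j) has_field_derivative matrix_triple_series (\<lambda>m n. D m (Suc n)) z w v $ i $ j) (at w)"
    if "norm z < 1" "norm w < 1" "norm v < 1" for z w v i j
  proof -
    have "((\<lambda>x. triple_series (\<lambda>m n p. D m n p $ i $ j) z x v) has_field_derivative
        matrix_triple_series (\<lambda>m n. D m (Suc n)) z w v $ i $ j) (at w)"
      using triple_series_deriv2[OF pochhammer_bounded_entry[OF assms(2)] that]
      by (simp add: matrix_triple_series_entry[OF pochhammer_bounded_shift2[OF assms(2)] that])
    then show ?thesis
      by (rule has_field_derivative_transform_within_open[of _ _ _ "ball 0 1"])
        (use that assms in \<open>auto simp: represented_by_def matrix_triple_series_entry\<close>)
  qed
  show "represented_by (partial2 f) (\<lambda>m n. D m (Suc n))"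
    by (auto simp: represented_by_def partial2_def vec_eq_iff DERIV_imp_deriv[OF der])
  show "(\<lambda>x. f z x v $ i $ j) field_differentiable (at w)"
    if "norm z < 1" "norm w < 1" "norm v < 1" for z w v i j
    using der[OF that] by (auto simp: field_differentiable_def)
qed

lemma represented_by_partial3:
  assumes "represented_by f D" "pochhammer_bounded D"
  shows "represented_by (partial3 f) (\<lambda>m n p. D m n (Suc p))"
    and "\<And>z w v i j. norm z < 1 \<Longrightarrow> norm w < 1 \<Longrightarrow> norm v < 1 \<Longrightarrow>
      (\<lambda>x. f z w x $ i $ j) field_differentiable (at v)"
proof -
  have der: "((\<lambda>x. f z w x $ i $ j) has_field_derivative matrix_triple_series (\<lambda>m n p. D m n (Suc p)) z w v $ i $ j) (at v)"
    if "norm z < 1" "norm w < 1" "norm v < 1" for z w v i j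
  proof -
    have "((\<lambda>x. triple_series (\<lambda>m n p. D m n p $ i $ j) z w x) has_field_derivative
        matrix_triple_series (\<lambda>m n p. D m n (Suc p)) z w v $ i $ j) (at v)"
      using triple_series_deriv3[OF pochhammer_bounded_entry[OF assms(2)] that]
      by (simp add: matrix_triple_series_entry[OF pochhammer_bounded_shift3[OF assms(2)] that])
    then show ?thesis
      by (rule has_field_derivative_transform_within_open[of _ _ _ "ball 0 1"])
        (use that assms in \<open>auto simp: represented_by_def matrix_triple_series_entry\<close>)
  qed
  show "represented_by (partial3 f) (\<lambda>m n p. D m n (Suc p))"
    by (auto simp: represented_by_def partial3_def vec_eq_iff DERIV_imp_deriv[OF der])
  show "(\<lambda>x. f z w x $ i $ j) field_differentiable (at v)"
    if "norm z < 1" "norm w < 1" "norm v < 1" for z w v i j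
    using der[OF that] by (auto simp: field_differentiable_def)
qed

lemma represented_by_mixed_partial:
  assumes "represented_by f D" "pochhammer_bounded D"
  shows "represented_by (mixed_partial m n p f) (\<lambda>m' n' p'. D (m' + m) (n' + n) (p' + p))"
proof -
  note bounded = pochhammer_bounded_shift[OF assms(2)]
  have 3: "represented_by ((partial3 ^^ p) f) (\<lambda>m' n' p'. D m' n' (p' + p))"
  proof (induction p)
    case (Suc p)
    from represented_by_partial3(1)[OF this bounded[of 0 0 p, simplified]] show ?case by simp
  qed (use assms in simp)
  have 2: "represented_by ((partial2 ^^ n) ((partial3 ^^ p) f)) (\<lambda>m' n' p'. D m' (n' + n) (p' + p))"
  proof (induction n)
    case (Suc n)
    from represented_by_partial2(1)[OF this bounded[of 0 n p, simplified]] show ?case by simp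
  qed (use 3 in simp)
  have "represented_by ((partial1 ^^ m) ((partial2 ^^ n) ((partial3 ^^ p) f)))
      (\<lambda>m' n' p'. D (m' + m) (n' + n) (p' + p))"
  proof (induction m)
    case (Suc m)
    from represented_by_partial1(1)[OF this bounded[of m n p, simplified]] show ?case by simp
  qed (use 2 in simp)
  then show ?thesis by (simp add: mixed_partial_def)
qed

text \<open>Every intermediate derivative is again represented by a series with shifted coefficients
  of the same growth class, hence differentiable on the polydisc.\<close>

lemma represented_by_mixed_partial_exists:
  assumes "represented_by f D" "pochhammer_bounded D"
  shows "mixed_partial_exists {(z, w, v). norm z < 1 \<and> norm w < 1 \<and> norm v < 1} m n p f"
proof -
  note rep = represented_by_mixed_partial[OF assms] pochhammer_bounded_shift[OF assms(2)]
  show ?thesis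
    unfolding mixed_partial_exists_def
    using represented_by_partial1(2)[OF rep] represented_by_partial2(2)[OF rep]
      represented_by_partial3(2)[OF rep] by auto
qed

section \<open>Coefficients of the Lauricella function and their shift\<close>

lemma mpochhammer_add: "mpochhammer M (k + j) = mpochhammer M k ** mpochhammer (M + mat (of_nat k)) j"
  by (induction j) (simp_all add: mat_add matrix_mul_assoc add_ac)

definition Lauricella_coeff :: "complex^'n^'n \<Rightarrow> complex^'n^'n \<Rightarrow> complex^'n^'n \<Rightarrow> complex^'n^'n \<Rightarrow>
    complex^'n^'n \<Rightarrow> complex^'n^'n \<Rightarrow> complex^'n^'n \<Rightarrow> complex^'n^'n \<Rightarrow> nat \<Rightarrow> nat \<Rightarrow> nat \<Rightarrow>
    complex^'n^'n" where
  "Lauricella_coeff A B Y A1 B1 B2 B3 C1 m n p =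
     ext_mBeta A B Y (A1 + mat (of_nat (m + n + p))) (C1 - A1)
     ** matrix_inv (mBeta A1 (C1 - A1))
     ** mpochhammer B1 m ** mpochhammer B2 n ** mpochhammer B3 p"

lemma represented_by_Lauricella:
  "represented_by (ext_Lauricella_FD3 A B Y A1 B1 B2 B3 C1) (Lauricella_coeff A B Y A1 B1 B2 B3 C1)"
  by (simp add: represented_by_def ext_Lauricella_FD3_def matrix_triple_series_def Lauricella_coeff_def)

lemma pochhammer_bounded_Lauricella_coeff:
  fixes A :: "complex^'n^'n"
  shows "pochhammer_bounded (Lauricella_coeff A B Y A1 B1 B2 B3 C1)"
proof -
  obtain K where K: "norm (ext_mBeta A B Y (A1 + mat (of_nat k)) (C1 - A1)) \<le> K" for k
    using ext_mBeta_bounded by blast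
  \<comment> \<open>One parameter above all three norms; the summand 1 makes it positive.\<close>
  define a where "a = norm B1 + norm B2 + norm B3 + 1"
  define e where "e = norm (mat 1 :: complex^'n^'n)"
  define b where "b = norm (matrix_inv (mBeta A1 (C1 - A1)))"
  have a: "a > 0"
    by (simp add: a_def add_nonneg_pos)
  have nn: "pochhammer a k \<ge> 0" "e \<ge> 0" "b \<ge> 0" "K \<ge> 0" for k
    using a pochhammer_nonneg order_trans[OF norm_ge_zero K] by (auto simp: e_def b_def)
  have poch: "norm (mpochhammer M k) \<le> e * pochhammer a k" if "norm M \<le> a" for M :: "complex^'n^'n" and k
  proof -
    have "pochhammer (norm M) k \<le> pochhammer a k"
      unfolding pochhammer_prod using that by (intro prod_mono) auto
    then have "e * pochhammer (norm M) k \<le> e * pochhammer a k"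
      using nn(2) by (rule mult_left_mono)
    then show ?thesis
      using norm_mpochhammer_le[of M k] by (simp add: e_def)
  qed
  have "norm (Lauricella_coeff A B Y A1 B1 B2 B3 C1 m n p) \<le>
      (K * b * e ^ 3) * (pochhammer a m * pochhammer a n * pochhammer a p)" for m n p
  proof -
    have "norm (Lauricella_coeff A B Y A1 B1 B2 B3 C1 m n p) \<le>
        K * b * (e * pochhammer a m) * (e * pochhammer a n) * (e * pochhammer a p)"
      unfolding Lauricella_coeff_def
      by (intro order_trans[OF norm_matrix_mult_le] mult_mono K poch mult_nonneg_nonneg nn norm_ge_zero)
        (auto simp: a_def b_def)
    then show ?thesis
      by (simp add: power3_eq_cube mult_ac)
  qed
  with a show ?thesis
    unfolding pochhammer_bounded_def by blast
qed

text \<open>Both sides contain the same extended beta value \<open>E\<close>. It commutes with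
  \<open>A1\<close> and \<open>C1\<close>, hence with the factor (A1)_k (C1)_k^(-1) released by the
  normalising beta matrix, which can move to the far left. The Pochhammer factors split off from
  \<open>B1\<close>, \<open>B2\<close>, \<open>B3\<close> move right past each other and never cross
  \<open>E\<close> or \<open>bk\<close>.\<close>

lemma Lauricella_coeff_shift:
  fixes A B Y A1 B1 B2 B3 C1 :: "complex^'n^'n" and m n p m' n' p' :: nat
  assumes stable: "positive_stable B" "positive_stable A1" "positive_stable C1" "positive_stable (C1 - A1)"
    and comm: "\<forall>M\<in>{A, A1, B, C1, Y}. \<forall>N\<in>{A, A1, B, C1, Y}. M ** N = N ** M"
    and commB: "\<forall>M\<in>{B1, B2, B3}. \<forall>N\<in>{B1, B2, B3}. M ** N = N ** M"
  defines "k \<equiv> m + n + p"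
  shows "Lauricella_coeff A B Y A1 B1 B2 B3 C1 (m' + m) (n' + n) (p' + p) =
    mpochhammer A1 k ** matrix_inv (mpochhammer C1 k)
    ** Lauricella_coeff A B Y (A1 + mat (of_nat k)) (B1 + mat (of_nat m)) (B2 + mat (of_nat n))
        (B3 + mat (of_nat p)) (C1 + mat (of_nat k)) m' n' p'
    ** (mpochhammer B1 m ** mpochhammer B2 n ** mpochhammer B3 p)"
proof -
  define a c where "a = mpochhammer A1 k" and "c = matrix_inv (mpochhammer C1 k)"
  define E where "E = ext_mBeta A B Y (A1 + mat (of_nat k) + mat (of_nat (m' + n' + p'))) (C1 - A1)"
  define b0 where "b0 = matrix_inv (mBeta A1 (C1 - A1))"
  define bk where "bk = matrix_inv (mBeta (A1 + mat (of_nat k)) (C1 - A1))"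
  have com: "mcomm M N" if "M \<in> {A, A1, B, C1, Y}" "N \<in> {A, A1, B, C1, Y}" for M N
    using comm that unfolding mcomm_def by blast
  have E_comm: "mcomm N E" if "N \<in> {A1, C1}" for N
    unfolding E_def using that
    by (intro mcomm_ext_mBeta stable mcomm_add mcomm_diff mcomm_mat com) auto
  have "mcomm E a" "mcomm E c"
    unfolding a_def c_def
    by (intro mcomm_matrix_inv mcomm_mpochhammer invertible_mpochhammer stable mcomm_sym[OF E_comm]; simp)+
  then have Eac: "mcomm E (a ** c)" by (rule mcomm_mult)
  have "positive_stable (A1 + (C1 - A1))" "mcomm A1 (C1 - A1)"
    using stable com[of A1 C1] by (auto intro: mcomm_diff)
  from matrix_inv_mBeta_shift[OF stable(2,4) this, of k]
  have b0: "b0 = a ** c ** bk"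
    by (simp add: a_def c_def b0_def bk_def)
  have Eb0: "E ** b0 = a ** c ** E ** bk"
    using Eac by (simp add: b0 mcomm_def matrix_mul_assoc)
  define p1 p2 p3 where "p1 = mpochhammer B1 m" and "p2 = mpochhammer B2 n" and "p3 = mpochhammer B3 p"
  define q1 q2 q3 where "q1 = mpochhammer (B1 + mat (of_nat m)) m'"
    and "q2 = mpochhammer (B2 + mat (of_nat n)) n'" and "q3 = mpochhammer (B3 + mat (of_nat p)) p'"
  have comB: "mcomm M N" if "M \<in> {B1, B2, B3}" "N \<in> {B1, B2, B3}" for M N
    using commB that unfolding mcomm_def by blast
  have com_poch: "mcomm (mpochhammer M i) (mpochhammer (N + mat c) j)"
    if "M \<in> {B1, B2, B3}" "N \<in> {B1, B2, B3}" for M N i j c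
    by (intro mcomm_mpochhammer mcomm_add mcomm_mat mcomm_sym[OF mcomm_mpochhammer] comB that)
  have com_pq: "p1 ** q1 = q1 ** p1" "p1 ** q2 = q2 ** p1" "p1 ** q3 = q3 ** p1"
    "p2 ** q2 = q2 ** p2" "p2 ** q3 = q3 ** p2" "p3 ** q3 = q3 ** p3"
    using com_poch unfolding p1_def p2_def p3_def q1_def q2_def q3_def mcomm_def by blast+
  \<comment> \<open>Each \<open>p\<close> factor is moved right across the \<open>q\<close> factors
    that follow it, while the relative order within the \<open>p\<close> and within the
    \<open>q\<close> factors is kept.\<close>
  have pq: "p1 ** q1 ** (p2 ** q2) ** (p3 ** q3) = q1 ** q2 ** q3 ** (p1 ** p2 ** p3)"
  proof -
    have "p1 ** q1 ** (p2 ** q2) ** (p3 ** q3) = q1 ** (p1 ** q2) ** p2 ** q3 ** p3"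
      by (simp only: com_pq(1,4,6) matrix_mul_assoc)
    also have "\<dots> = q1 ** q2 ** p1 ** (p2 ** q3) ** p3"
      by (simp only: com_pq(2) matrix_mul_assoc)
    also have "\<dots> = q1 ** q2 ** (p1 ** q3) ** p2 ** p3"
      by (simp only: com_pq(5) matrix_mul_assoc)
    also have "\<dots> = q1 ** q2 ** q3 ** (p1 ** p2 ** p3)"
      by (simp only: com_pq(3) matrix_mul_assoc)
    finally show ?thesis .
  qed
  have arg: "A1 + mat (of_nat (m' + m + (n' + n) + (p' + p))) =
      A1 + mat (of_nat k) + mat (of_nat (m' + n' + p'))"
    by (simp add: k_def add_ac flip: mat_add)
  have diff: "C1 + mat (of_nat k) - (A1 + mat (of_nat k)) = C1 - A1"
    by simp
  have poch: "mpochhammer B1 (m' + m) = p1 ** q1" "mpochhammer B2 (n' + n) = p2 ** q2"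
    "mpochhammer B3 (p' + p) = p3 ** q3"
    unfolding p1_def p2_def p3_def q1_def q2_def q3_def
    by (simp_all only: add.commute[of m' m] add.commute[of n' n] add.commute[of p' p] mpochhammer_add)
  have "Lauricella_coeff A B Y A1 B1 B2 B3 C1 (m' + m) (n' + n) (p' + p) =
      E ** b0 ** (p1 ** q1) ** (p2 ** q2) ** (p3 ** q3)"
    by (simp only: Lauricella_coeff_def arg poch E_def b0_def)
  also have "\<dots> = a ** c ** E ** bk ** (p1 ** q1 ** (p2 ** q2) ** (p3 ** q3))"
    by (simp only: Eb0 matrix_mul_assoc)
  also have "\<dots> = a ** c ** (E ** bk ** q1 ** q2 ** q3) ** (p1 ** p2 ** p3)"
    by (subst pq) (simp only: matrix_mul_assoc)
  finally show ?thesis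
    by (simp only: Lauricella_coeff_def diff a_def c_def E_def bk_def p1_def p2_def p3_def
        q1_def q2_def q3_def)
qed

theorem theorem5p6:
  fixes A B Y A1 B1 B2 B3 C1 :: "complex^'r^'r" and m n p :: nat
  assumes "positive_stable A" and "positive_stable A1" and "positive_stable B"
    and "positive_stable B1" and "positive_stable B2" and "positive_stable B3"
    and "positive_stable C1" and "positive_stable (C1 - A1)" and "positive_stable Y"
    and "\<forall>M\<in>{A, A1, B, C1, Y}. \<forall>N\<in>{A, A1, B, C1, Y}. M ** N = N ** M"
    and "\<forall>M\<in>{B1, B2, B3}. \<forall>N\<in>{B1, B2, B3}. M ** N = N ** M"
  shows "mixed_partial_exists {(z, w, v). norm z < 1 \<and> norm w < 1 \<and> norm v < 1} m n p
           (ext_Lauricella_FD3 A B Y A1 B1 B2 B3 C1) \<and>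
         (\<forall>z w v. norm z < 1 \<and> norm w < 1 \<and> norm v < 1 \<longrightarrow>
           mixed_partial m n p (ext_Lauricella_FD3 A B Y A1 B1 B2 B3 C1) z w v =
             mpochhammer A1 (m + n + p) ** matrix_inv (mpochhammer C1 (m + n + p))
             ** ext_Lauricella_FD3 A B Y (A1 + mat (of_nat (m + n + p)))
                  (B1 + mat (of_nat m)) (B2 + mat (of_nat n)) (B3 + mat (of_nat p))
                  (C1 + mat (of_nat (m + n + p))) z w v
             ** mpochhammer B1 m ** mpochhammer B2 n ** mpochhammer B3 p)"
proof (intro conjI allI impI)
  note rep = represented_by_Lauricella[of A B Y A1 B1 B2 B3 C1]
    and bounded = pochhammer_bounded_Lauricella_coeff[of A B Y A1 B1 B2 B3 C1]
  show "mixed_partial_exists {(z, w, v). norm z < 1 \<and> norm w < 1 \<and> norm v < 1} m n p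
      (ext_Lauricella_FD3 A B Y A1 B1 B2 B3 C1)"
    using rep bounded by (rule represented_by_mixed_partial_exists)
  fix z w v :: complex
  assume "norm z < 1 \<and> norm w < 1 \<and> norm v < 1"
  then have zwv: "norm z < 1" "norm w < 1" "norm v < 1" by auto
  let ?k = "mat (of_nat (m + n + p)) :: complex^'r^'r"
  let ?F = "ext_Lauricella_FD3 A B Y (A1 + ?k) (B1 + mat (of_nat m)) (B2 + mat (of_nat n))
    (B3 + mat (of_nat p)) (C1 + ?k) z w v"
  let ?L = "mpochhammer A1 (m + n + p) ** matrix_inv (mpochhammer C1 (m + n + p))"
  let ?R = "mpochhammer B1 m ** mpochhammer B2 n ** mpochhammer B3 p"
  have "mixed_partial m n p (ext_Lauricella_FD3 A B Y A1 B1 B2 B3 C1) z w v =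
      matrix_triple_series (\<lambda>m' n' p'. Lauricella_coeff A B Y A1 B1 B2 B3 C1 (m' + m) (n' + n) (p' + p)) z w v"
    using represented_by_mixed_partial[OF rep bounded] zwv unfolding represented_by_def by blast
  \<comment> \<open>The shifted coefficients are those of the raised parameters, framed by constant
    matrices; the growth bound at the raised parameters allows these to leave the sum.\<close>
  also have "\<dots> = ?L ** matrix_triple_series (Lauricella_coeff A B Y (A1 + ?k) (B1 + mat (of_nat m))
      (B2 + mat (of_nat n)) (B3 + mat (of_nat p)) (C1 + ?k)) z w v ** ?R"
    by (simp only: Lauricella_coeff_shift[OF assms(3,2,7,8,10,11)]
        matrix_triple_series_mult[OF pochhammer_bounded_Lauricella_coeff zwv])
  also have "\<dots> = ?L ** ?F ** ?R"
    using represented_by_Lauricella zwv unfolding represented_by_def by metis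
  finally show "mixed_partial m n p (ext_Lauricella_FD3 A B Y A1 B1 B2 B3 C1) z w v =
      ?L ** ?F ** mpochhammer B1 m ** mpochhammer B2 n ** mpochhammer B3 p"
    by (simp only: matrix_mul_assoc)
qed

end
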